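(* Let $X$ be a mean-zero random vector in $\mathbb R^p$ (not almost surely zero). If $\mathbb E[\|X\|^{4+4\tau}]<\infty$ for some constant $0<\tau\le1/2$, then there exists some absolute positive constant $C$ such that $$\big|\mathbb E[g(X_1,X_2,X_3,X_4)]\big|\le B_X^{-2}\,\mathbb E[(X_1^T\Sigma_xX_2)^2]+C\,B_X^{-(2+2\tau)}L_{x,\tau}^{(2+\tau)/(1+\tau)}.$$
   Context: $\|\cdot\|$ is the Euclidean norm; $X_1,X_2,X_3,X_4$ are i.i.d. copies of $X$; $\Sigma_x=\mathbb E[XX^T]$. $d(X_1,X_2)=\|X_1-X_2\|-\mathbb E[\|X_1-X_2\|\mid X_1]-\mathbb E[\|X_1-X_2\|\mid X_2]+\mathbb E\|X_1-X_2\|$ and $g(X_1,X_2,X_3,X_4)=d(X_1,X_2)\,d(X_1,X_3)\,d(X_2,X_4)\,d(X_3,X_4)$. $B_X=\mathbb E\|X_1-X_2\|^2=2\,\mathbb E\|X\|^2$. $L_{x,\tau}=\mathbb E\big(\big|\|X\|^2-\mathbb E\|X\|^2\big|^{2+2\tau}\big)+\mathbb E\big(|X_1^TX_2|^{2+2\tau}\big)$. *)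

theory Defs
  imports "HOL-Probability.Probability"
begin

text \<open>
  The dimension \<open>p\<close> has to be quantified inside the statement, below the absolute constant, so a
  vector in \<open>R^p\<close> is a function \<open>nat \<Rightarrow> real\<close> of which only the coordinates \<open>i < p\<close> matter, and
  the Borel space of \<open>R^p\<close> is the product sigma-algebra on \<open>{..<p}\<close>.
\<close>

abbreviation Rvec :: "nat \<Rightarrow> (nat \<Rightarrow> real) measure" where
  "Rvec p \<equiv> PiM {..<p} (\<lambda>_. borel)"

definition vnorm :: "nat \<Rightarrow> (nat \<Rightarrow> real) \<Rightarrow> real" where
  "vnorm p x = L2_set x {..<p}"

definition vdist :: "nat \<Rightarrow> (nat \<Rightarrow> real) \<Rightarrow> (nat \<Rightarrow> real) \<Rightarrow> real" where
  "vdist p x y = vnorm p (\<lambda>i. x i - y i)"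

definition vinner :: "nat \<Rightarrow> (nat \<Rightarrow> real) \<Rightarrow> (nat \<Rightarrow> real) \<Rightarrow> real" where
  "vinner p x y = (\<Sum>i<p. x i * y i)"

definition vquad :: "nat \<Rightarrow> (nat \<Rightarrow> real) \<Rightarrow> (nat \<Rightarrow> nat \<Rightarrow> real) \<Rightarrow> (nat \<Rightarrow> real) \<Rightarrow> real" where
  "vquad p x A y = (\<Sum>i<p. \<Sum>j<p. x i * A i j * y j)"

definition cond_exp_given ::
    "'w measure \<Rightarrow> nat \<Rightarrow> ('w \<Rightarrow> real) \<Rightarrow> ('w \<Rightarrow> nat \<Rightarrow> real) \<Rightarrow> 'w \<Rightarrow> real" where
  "cond_exp_given M p Z Y = real_cond_exp M (vimage_algebra (space M) Y (Rvec p)) Z"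

definition dcent ::
    "'w measure \<Rightarrow> nat \<Rightarrow> ('w \<Rightarrow> nat \<Rightarrow> real) \<Rightarrow> ('w \<Rightarrow> nat \<Rightarrow> real) \<Rightarrow> 'w \<Rightarrow> real" where
  "dcent M p Y Z \<omega> =
     vdist p (Y \<omega>) (Z \<omega>)
     - cond_exp_given M p (\<lambda>\<omega>. vdist p (Y \<omega>) (Z \<omega>)) Y \<omega>
     - cond_exp_given M p (\<lambda>\<omega>. vdist p (Y \<omega>) (Z \<omega>)) Z \<omega>
     + (\<integral>\<omega>'. vdist p (Y \<omega>') (Z \<omega>') \<partial>M)"

definition gfun ::
    "'w measure \<Rightarrow> nat \<Rightarrow> (nat \<Rightarrow> 'w \<Rightarrow> nat \<Rightarrow> real) \<Rightarrow> 'w \<Rightarrow> real" where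
  "gfun M p X \<omega> =
     dcent M p (X 1) (X 2) \<omega> * dcent M p (X 1) (X 3) \<omega> *
     dcent M p (X 2) (X 4) \<omega> * dcent M p (X 3) (X 4) \<omega>"

text \<open>
  A random vector is given by its law \<open>P\<close> (a probability measure on \<open>Rvec p\<close>; the random vector
  itself is the identity on \<open>P\<close>), so that the constant cannot depend on the type of a sample space.
  The copies \<open>X\<^sub>1, ..., X\<^sub>4\<close> are the coordinates of the product of four copies of \<open>P\<close>.
\<close>

abbreviation copies :: "(nat \<Rightarrow> real) measure \<Rightarrow> (nat \<Rightarrow> nat \<Rightarrow> real) measure" where
  "copies P \<equiv> PiM {1..4} (\<lambda>_. P)"

abbreviation copy :: "nat \<Rightarrow> (nat \<Rightarrow> nat \<Rightarrow> real) \<Rightarrow> nat \<Rightarrow> real" where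
  "copy i \<equiv> (\<lambda>\<omega>. \<omega> i)"

lemma copies_iid:
  assumes "prob_space P"
  shows "i \<in> {1..4} \<Longrightarrow> distr (copies P) P (copy i) = P"
    and "prob_space.indep_vars (copies P) (\<lambda>_. P) copy {1..4}"
proof -
  interpret P: prob_space P by fact
  interpret Q: prob_space "copies P" by (intro prob_space_PiM assms)
  have d: "distr (copies P) P (copy i) = P" if "i \<in> {1..4}" for i
    using distr_PiM_component[of "{1..4}" "\<lambda>_. P" i] assms that by simp
  then show "i \<in> {1..4} \<Longrightarrow> distr (copies P) P (copy i) = P" .
  have "distr (copies P) (copies P) (\<lambda>\<omega>. \<lambda>i\<in>{1..4}. \<omega> i) = distr (copies P) (copies P) (\<lambda>\<omega>. \<omega>)"
    by (intro distr_cong) (auto simp: space_PiM)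
  also have "\<dots> = PiM {1..4} (\<lambda>i. distr (copies P) P (copy i))"
    unfolding distr_id by (intro PiM_cong refl d[symmetric])
  finally show "Q.indep_vars (\<lambda>_. P) copy {1..4}"
    by (subst Q.indep_vars_iff_distr_eq_PiM') auto
qed

definition Sigma_x :: "(nat \<Rightarrow> real) measure \<Rightarrow> nat \<Rightarrow> nat \<Rightarrow> real" where
  "Sigma_x P i j = (\<integral>x. x i * x j \<partial>P)"

definition B_X :: "nat \<Rightarrow> (nat \<Rightarrow> real) measure \<Rightarrow> real" where
  "B_X p P = (\<integral>\<omega>. (vdist p (copy 1 \<omega>) (copy 2 \<omega>))\<^sup>2 \<partial>copies P)"

definition L_x :: "nat \<Rightarrow> (nat \<Rightarrow> real) measure \<Rightarrow> real \<Rightarrow> real" where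
  "L_x p P \<tau> =
     (\<integral>x. \<bar>(vnorm p x)\<^sup>2 - (\<integral>y. (vnorm p y)\<^sup>2 \<partial>P)\<bar> powr (2 + 2 * \<tau>) \<partial>P)
     + (\<integral>\<omega>. \<bar>vinner p (copy 1 \<omega>) (copy 2 \<omega>)\<bar> powr (2 + 2 * \<tau>) \<partial>copies P)"

end

(*
With B = E|X1 - X2|^2 one has |x - y|^2 = B + V(x,y) for V(x,y) = n(x) + n(y) - 2 x^T y, where
n(x) = |x|^2 - E|X|^2.  Completing the square,

  |x - y| = sqrt B + V(x,y) / (2 sqrt B) - (|x - y| - sqrt B)^2 / (2 sqrt B),

so the double centring of -|x - y| is x^T y / sqrt B plus the double centring of the last remainder.
E[g] is the integral of this kernel around the 4-cycle 1-2-4-3.  The term without remainder is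
B^(-2) E[(X1^T Sigma X2)^2].  Cauchy-Schwarz around the cycle bounds the terms with at least two
remainders.  In a term with a single remainder the centring drops out; there the remainder is
estimated by a power 1 + 2 tau of |V|, and, for s = 2 + 2 tau, x^(s-1) y <= x^s + y^s separates the factors into two
products over disjoint pairs of copies, which are independent.
*)

theory Submission
  imports Defs
begin

section \<open>Elementary inequalities\<close>

text \<open>The obstacle is the order of the error. After division by a scale \<open>r\<close> with
  \<open>L_x p P \<tau> \<le> r powr (2 + 2 * \<tau>)\<close>, the main kernel \<open>a\<close> has
  absolute moment of order \<open>2 + 2 * \<tau>\<close> at most 1, and the remainder
  \<open>q\<close> satisfies both \<open>q \<le> v\<close> and
  \<open>q \<le> \<epsilon> * v\<^sup>2\<close> with \<open>\<epsilon> = r / B\<close>. The target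
  is an error of order \<open>\<epsilon> powr (2 * \<tau>)\<close>. Interpolating the two bounds
  gives the mean square of \<open>q\<close> exactly this order, so Cauchy-Schwarz suffices once two
  remainders occur; with one remainder it would yield only the square root,
  \<open>\<epsilon> powr \<tau>\<close>. Hence the separate pointwise treatment of single
  remainders, for which the centring must be removed first: the pointwise bounds concern
  \<open>q\<close> and not its row means. Nothing forces \<open>\<epsilon>\<close> to be small, so
  an absolute bound on the mean square of \<open>q\<close> is carried along to absorb higher
  powers.\<close>

lemma Cauchy_Schwarz_integral:
  fixes f g :: "'a \<Rightarrow> real"
  assumes [measurable]: "f \<in> borel_measurable M" "g \<in> borel_measurable M"
    and f: "integrable M (\<lambda>x. (f x)\<^sup>2)" and g: "integrable M (\<lambda>x. (g x)\<^sup>2)"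
  shows "integrable M (\<lambda>x. f x * g x)"
    and "(\<integral>x. f x * g x \<partial>M)\<^sup>2 \<le> (\<integral>x. (f x)\<^sup>2 \<partial>M) * (\<integral>x. (g x)\<^sup>2 \<partial>M)"
proof -
  show fg: "integrable M (\<lambda>x. f x * g x)"
  proof (rule Bochner_Integration.integrable_bound[OF Bochner_Integration.integrable_add[OF f g]])
    show "AE x in M. norm (f x * g x) \<le> norm ((f x)\<^sup>2 + (g x)\<^sup>2)"
    proof (rule AE_I2)
      fix x
      have "2 * \<bar>f x * g x\<bar> \<le> (f x)\<^sup>2 + (g x)\<^sup>2"
        using sum_squares_bound[of "\<bar>f x\<bar>" "\<bar>g x\<bar>"] by (simp add: abs_mult)
      then show "norm (f x * g x) \<le> norm ((f x)\<^sup>2 + (g x)\<^sup>2)"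
        by simp
    qed
  qed simp
  define \<alpha> where "\<alpha> = (\<integral>x. (f x)\<^sup>2 \<partial>M)"
  define \<beta> where "\<beta> = (\<integral>x. (g x)\<^sup>2 \<partial>M)"
  define c where "c = (\<integral>x. f x * g x \<partial>M)"
  \<comment> \<open>The coefficients \<open>c\<close> and \<open>\<alpha>\<close> make the expanded
    square factor as \<open>\<alpha> * (\<alpha> * \<beta> - c\<^sup>2)\<close>, without any
    division; only \<open>\<alpha> = 0\<close> needs an argument of its own.\<close>
  have "0 \<le> (\<integral>x. (c * f x - \<alpha> * g x)\<^sup>2 \<partial>M)"
    by (rule Bochner_Integration.integral_nonneg) simp
  also have "(\<lambda>x. (c * f x - \<alpha> * g x)\<^sup>2)
      = (\<lambda>x. c\<^sup>2 * (f x)\<^sup>2 - 2 * c * \<alpha> * (f x * g x) + \<alpha>\<^sup>2 * (g x)\<^sup>2)"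
    by (auto simp: power2_eq_square algebra_simps)
  also have "(\<integral>x. c\<^sup>2 * (f x)\<^sup>2 - 2 * c * \<alpha> * (f x * g x) + \<alpha>\<^sup>2 * (g x)\<^sup>2 \<partial>M)
      = c\<^sup>2 * \<alpha> - 2 * c * \<alpha> * c + \<alpha>\<^sup>2 * \<beta>"
    using f g fg by (simp add: \<alpha>_def \<beta>_def c_def)
  finally have *: "0 \<le> \<alpha> * (\<alpha> * \<beta> - c\<^sup>2)"
    by (simp add: power2_eq_square algebra_simps)
  have "\<alpha> \<ge> 0"
    unfolding \<alpha>_def by (rule Bochner_Integration.integral_nonneg) simp
  have "c\<^sup>2 \<le> \<alpha> * \<beta>"
  proof (cases "\<alpha> = 0")
    case True
    then have "AE x in M. (f x)\<^sup>2 = 0"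
      using integral_nonneg_eq_0_iff_AE[OF f] by (simp add: \<alpha>_def)
    then have "AE x in M. f x * g x = 0"
      by auto
    then have "c = 0"
      unfolding c_def by (rule integral_eq_zero_AE)
    then show ?thesis
      using True by simp
  next
    case False
    with \<open>\<alpha> \<ge> 0\<close> * show ?thesis
      by (simp add: zero_le_mult_iff)
  qed
  then show "(\<integral>x. f x * g x \<partial>M)\<^sup>2 \<le> (\<integral>x. (f x)\<^sup>2 \<partial>M) * (\<integral>x. (g x)\<^sup>2 \<partial>M)"
    by (simp only: \<alpha>_def \<beta>_def c_def)
qed

lemma powr_le_one_plus_powr:
  fixes u :: real
  assumes "0 \<le> u" "0 \<le> r" "r \<le> s"
  shows "u powr r \<le> 1 + u powr s"
proof (cases "u \<le> 1")
  case True
  then have "u powr r \<le> 1"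
    using assms by (simp add: powr_le1)
  then show ?thesis
    by (smt (verit) powr_ge_zero)
next
  case False
  then have "u powr r \<le> u powr s"
    using assms by (simp add: powr_mono)
  then show ?thesis
    by simp
qed

lemma power2_le_one_plus_powr:
  fixes u :: real
  assumes "2 \<le> s"
  shows "u\<^sup>2 \<le> 1 + \<bar>u\<bar> powr s"
  using powr_le_one_plus_powr[of "\<bar>u\<bar>" 2 s] assms by simp

text \<open>Both factors are at most \<open>max w c\<close>, so the product is at most its power of
  order \<open>s\<close>. This crude form of Young's inequality avoids conjugate exponents and
  weights.\<close>

lemma powr_mult_le_add_powr:
  fixes w c :: real
  assumes "0 \<le> w" "0 \<le> c" "1 \<le> s"
  shows "w powr (s - 1) * c \<le> w powr s + c powr s"
proof -
  define m where "m = max w c"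
  have "w powr (s - 1) * c \<le> m powr (s - 1) * m"
    using assms by (intro mult_mono powr_mono2) (auto simp: m_def)
  also have "\<dots> = m powr s"
    using assms by (cases "m = 0") (auto simp: m_def powr_mult_base' powr_diff)
  also have "\<dots> \<le> w powr s + c powr s"
    by (auto simp: m_def max_def)
  finally show ?thesis .
qed

text \<open>Split \<open>q\<close> as \<open>q powr (1 - \<theta>) * q powr \<theta>\<close>; the
  linear bound is used in the first factor, the quadratic one in the second. It is applied with
  \<open>\<theta> = \<tau>\<close> to mean squares and with \<open>\<theta> = 2 * \<tau>\<close> to
  a single remainder; the latter calls for \<open>\<tau> \<le> 1 / 2\<close>.\<close>

lemma interpolated_bound:
  fixes q v \<epsilon> \<theta> :: real
  assumes "0 \<le> q" "q \<le> v" "q \<le> \<epsilon> * v\<^sup>2" "0 \<le> \<epsilon>" "0 \<le> \<theta>" "\<theta> \<le> 1"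
  shows "q \<le> \<epsilon> powr \<theta> * v powr (1 + \<theta>)"
proof (cases "q = 0")
  case False
  with assms have pos: "q > 0" "v > 0"
    by auto
  then have "\<epsilon> > 0"
    using assms by (cases "\<epsilon> = 0") auto
  note pos = pos this
  have "q = q powr (1 - \<theta>) * q powr \<theta>"
    using pos by (simp flip: powr_add)
  also have "\<dots> \<le> v powr (1 - \<theta>) * (\<epsilon> * v\<^sup>2) powr \<theta>"
    using assms pos by (intro mult_mono powr_mono2) auto
  also have "\<dots> = \<epsilon> powr \<theta> * v powr (1 + \<theta>)"
    using pos by (simp add: powr_mult powr_powr add.commute flip: powr_add powr_numeral)
  finally show ?thesis .
qed simp

text \<open>Total mass one gives the constant 1 the integral 1. Together with
  \<open>powr_le_one_plus_powr\<close> this trades any lower moment for the moment of order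
  \<open>s\<close>, at the price of an additive 1.\<close>

lemma (in prob_space)
  fixes f g :: "'a \<Rightarrow> real"
  assumes [measurable]: "f \<in> borel_measurable M" and g: "integrable M g"
    and f: "\<And>x. 0 \<le> f x" "\<And>x. f x \<le> 1 + g x"
  shows integrable_le_one_plus: "integrable M f"
    and integral_le_one_plus: "integral\<^sup>L M f \<le> 1 + integral\<^sup>L M g"
proof -
  show *: "integrable M f"
  proof (rule Bochner_Integration.integrable_bound)
    show "integrable M (\<lambda>x. 1 + g x)"
      using g by simp
    show "AE x in M. norm (f x) \<le> norm (1 + g x)"
      using f by (intro AE_I2) (smt (verit) real_norm_def)
  qed simp
  have "integral\<^sup>L M f \<le> (\<integral>x. 1 + g x \<partial>M)"
    using * g f by (intro integral_mono) auto
  then show "integral\<^sup>L M f \<le> 1 + integral\<^sup>L M g"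
    using g by (simp add: prob_space)
qed

declare One_nat_def [simp del]

section \<open>Cycles of kernels in independent copies\<close>

type_synonym kernel = "(nat \<Rightarrow> real) \<times> (nat \<Rightarrow> real) \<Rightarrow> real"

locale iid_copies = prob_space P for P :: "(nat \<Rightarrow> real) measure"
begin

sublocale pair: pair_prob_space P P ..

sublocale copies: prob_space "copies P"
  by (intro prob_space_PiM prob_space_axioms)

abbreviation P2 :: "((nat \<Rightarrow> real) \<times> (nat \<Rightarrow> real)) measure" where
  "P2 \<equiv> P \<Otimes>\<^sub>M P"

sublocale pair2: pair_prob_space P2 P2 ..

lemma copy_measurable [measurable]: "i \<in> {1..4} \<Longrightarrow> copy i \<in> copies P \<rightarrow>\<^sub>M P"
  by measurable

section \<open>Joint laws of two and of four distinct copies\<close>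

lemma distr_two_copies:
  assumes "i \<in> {1..4}" "j \<in> {1..4}" "i \<noteq> j"
  shows "distr (copies P) P2 (\<lambda>\<omega>. (\<omega> i, \<omega> j)) = P2"
proof -
  have *: "copies.indep_var (PiM {i} (\<lambda>_. P)) (\<lambda>\<omega>. restrict (\<lambda>i. copy i \<omega>) {i})
      (PiM {j} (\<lambda>_. P)) (\<lambda>\<omega>. restrict (\<lambda>i. copy i \<omega>) {j})"
    using assms by (intro copies.indep_var_restrict[OF copies_iid(2)[OF prob_space_axioms]]) auto
  have "copies.indep_var P (copy i \<circ> (\<lambda>\<omega>. restrict (\<lambda>i. copy i \<omega>) {i}))
      P (copy j \<circ> (\<lambda>\<omega>. restrict (\<lambda>i. copy i \<omega>) {j}))"
    by (rule copies.indep_var_compose[OF *]) measurable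
  then have "copies.indep_var P (copy i) P (copy j)"
    by (simp add: o_def)
  then show ?thesis
    using assms copies_iid(1)[OF prob_space_axioms] by (simp add: copies.indep_var_distribution_eq)
qed

text \<open>Any ordering of the four labels is allowed, so that a later Fubini argument can choose
  which two vertices of the cycle are integrated out first.\<close>

lemma distr_four_copies:
  assumes "distinct [i, j, k, l]" "set [i, j, k, l] \<subseteq> {1..4}"
  shows "distr (copies P) (P2 \<Otimes>\<^sub>M P2) (\<lambda>\<omega>. ((\<omega> i, \<omega> j), (\<omega> k, \<omega> l))) = P2 \<Otimes>\<^sub>M P2"
proof -
  have *: "copies.indep_var (PiM {i, j} (\<lambda>_. P)) (\<lambda>\<omega>. restrict (\<lambda>i. copy i \<omega>) {i, j})
      (PiM {k, l} (\<lambda>_. P)) (\<lambda>\<omega>. restrict (\<lambda>i. copy i \<omega>) {k, l})"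
    using assms by (intro copies.indep_var_restrict[OF copies_iid(2)[OF prob_space_axioms]]) auto
  have "copies.indep_var P2 ((\<lambda>\<omega>. (\<omega> i, \<omega> j)) \<circ> (\<lambda>\<omega>. restrict (\<lambda>i. copy i \<omega>) {i, j}))
      P2 ((\<lambda>\<omega>. (\<omega> k, \<omega> l)) \<circ> (\<lambda>\<omega>. restrict (\<lambda>i. copy i \<omega>) {k, l}))"
    by (rule copies.indep_var_compose[OF *]) measurable
  then have "copies.indep_var P2 (\<lambda>\<omega>. (\<omega> i, \<omega> j)) P2 (\<lambda>\<omega>. (\<omega> k, \<omega> l))"
    by (simp add: o_def)
  then show ?thesis
    using assms distr_two_copies[of i j] distr_two_copies[of k l]
    by (simp add: copies.indep_var_distribution_eq)
qed

lemma
  fixes f :: "(nat \<Rightarrow> real) \<times> (nat \<Rightarrow> real) \<Rightarrow> real"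
  assumes "i \<in> {1..4}" "j \<in> {1..4}" "i \<noteq> j" and [measurable]: "f \<in> borel_measurable P2"
  shows integral_two_copies: "(\<integral>\<omega>. f (\<omega> i, \<omega> j) \<partial>copies P) = integral\<^sup>L P2 f"
    and integrable_two_copies_iff: "integrable (copies P) (\<lambda>\<omega>. f (\<omega> i, \<omega> j)) \<longleftrightarrow> integrable P2 f"
proof -
  have mT: "(\<lambda>\<omega>. (\<omega> i, \<omega> j)) \<in> copies P \<rightarrow>\<^sub>M P2"
    using assms by measurable
  show "(\<integral>\<omega>. f (\<omega> i, \<omega> j) \<partial>copies P) = integral\<^sup>L P2 f"
    using integral_distr[of _ "copies P" _ f, OF mT] by (simp add: distr_two_copies[OF assms(1-3)])
  show "integrable (copies P) (\<lambda>\<omega>. f (\<omega> i, \<omega> j)) \<longleftrightarrow> integrable P2 f"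
    using integrable_distr_eq[of _ "copies P" _ f, OF mT] by (simp add: distr_two_copies[OF assms(1-3)])
qed

lemma
  fixes f :: "((nat \<Rightarrow> real) \<times> (nat \<Rightarrow> real)) \<times> ((nat \<Rightarrow> real) \<times> (nat \<Rightarrow> real)) \<Rightarrow> real"
  assumes "distinct [i, j, k, l]" "set [i, j, k, l] \<subseteq> {1..4}"
    and [measurable]: "f \<in> borel_measurable (P2 \<Otimes>\<^sub>M P2)"
  shows integral_four_copies:
      "(\<integral>\<omega>. f ((\<omega> i, \<omega> j), (\<omega> k, \<omega> l)) \<partial>copies P) = integral\<^sup>L (P2 \<Otimes>\<^sub>M P2) f"
    and integrable_four_copies_iff:
      "integrable (copies P) (\<lambda>\<omega>. f ((\<omega> i, \<omega> j), (\<omega> k, \<omega> l))) \<longleftrightarrow> integrable (P2 \<Otimes>\<^sub>M P2) f"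
proof -
  have mT: "(\<lambda>\<omega>. ((\<omega> i, \<omega> j), (\<omega> k, \<omega> l))) \<in> copies P \<rightarrow>\<^sub>M P2 \<Otimes>\<^sub>M P2"
    using assms by (intro measurable_Pair) auto
  show "(\<integral>\<omega>. f ((\<omega> i, \<omega> j), (\<omega> k, \<omega> l)) \<partial>copies P) = integral\<^sup>L (P2 \<Otimes>\<^sub>M P2) f"
    using integral_distr[of _ "copies P" _ f, OF mT] by (simp add: distr_four_copies[OF assms(1,2)])
  show "integrable (copies P) (\<lambda>\<omega>. f ((\<omega> i, \<omega> j), (\<omega> k, \<omega> l))) \<longleftrightarrow> integrable (P2 \<Otimes>\<^sub>M P2) f"
    using integrable_distr_eq[of _ "copies P" _ f, OF mT] by (simp add: distr_four_copies[OF assms(1,2)])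
qed

lemma
  fixes f g :: "(nat \<Rightarrow> real) \<times> (nat \<Rightarrow> real) \<Rightarrow> real"
  assumes "distinct [i, j, k, l]" "set [i, j, k, l] \<subseteq> {1..4}"
    and f: "integrable P2 f" and g: "integrable P2 g"
  shows integrable_copies_mult: "integrable (copies P) (\<lambda>\<omega>. f (\<omega> i, \<omega> j) * g (\<omega> k, \<omega> l))"
    and integral_copies_mult: "(\<integral>\<omega>. f (\<omega> i, \<omega> j) * g (\<omega> k, \<omega> l) \<partial>copies P)
      = integral\<^sup>L P2 f * integral\<^sup>L P2 g"
proof -
  have [measurable]: "f \<in> borel_measurable P2" "g \<in> borel_measurable P2"
    using f g by auto
  have fg: "integrable (P2 \<Otimes>\<^sub>M P2) (\<lambda>(u, v). f u * g v)"
    using f g by (intro pair2.Fubini_integrable) (auto simp: abs_mult)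
  show "integrable (copies P) (\<lambda>\<omega>. f (\<omega> i, \<omega> j) * g (\<omega> k, \<omega> l))"
    using integrable_four_copies_iff[OF assms(1,2), of "\<lambda>(u, v). f u * g v"] fg by simp
  show "(\<integral>\<omega>. f (\<omega> i, \<omega> j) * g (\<omega> k, \<omega> l) \<partial>copies P) = integral\<^sup>L P2 f * integral\<^sup>L P2 g"
    using integral_four_copies[OF assms(1,2), of "\<lambda>(u, v). f u * g v"]
      pair2.integral_fst'[OF fg] by simp
qed

section \<open>Square-integrable kernels and their cycle integrals\<close>

definition sq_int :: "((nat \<Rightarrow> real) \<times> (nat \<Rightarrow> real) \<Rightarrow> real) \<Rightarrow> bool" where
  "sq_int f \<longleftrightarrow> f \<in> borel_measurable P2 \<and> integrable P2 (\<lambda>z. (f z)\<^sup>2)"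

lemma sq_int_measurable [measurable_dest]: "sq_int f \<Longrightarrow> f \<in> borel_measurable P2"
  by (simp add: sq_int_def)

lemma sq_intD: "sq_int f \<Longrightarrow> integrable P2 (\<lambda>z. (f z)\<^sup>2)"
  by (simp add: sq_int_def)

lemma sq_int_add:
  assumes "sq_int f" "sq_int g"
  shows "sq_int (\<lambda>z. f z + g z)"
  unfolding sq_int_def
proof
  note [measurable] = assms[THEN sq_int_measurable]
  show "(\<lambda>z. f z + g z) \<in> borel_measurable P2"
    by measurable
  show "integrable P2 (\<lambda>z. (f z + g z)\<^sup>2)"
    using assms[THEN sq_intD] Cauchy_Schwarz_integral(1)[of f P2 g]
    by (simp add: power2_sum mult.assoc)
qed

lemma sq_int_uminus: "sq_int f \<Longrightarrow> sq_int (\<lambda>z. - f z)"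
  by (auto simp: sq_int_def)

text \<open>The cycle runs \<open>i\<close>-\<open>j\<close>-\<open>l\<close>-\<open>k\<close>, so
  \<open>f\<close>, \<open>m\<close> and likewise \<open>g\<close>, \<open>h\<close> sit on opposite
  edges. The labels are parameters because rotations and reflections of the cycle are then instances
  of the same definition, and any chosen edge can be moved into the first slot.\<close>

definition cycle_at ::
    "nat \<Rightarrow> nat \<Rightarrow> nat \<Rightarrow> nat \<Rightarrow> kernel \<Rightarrow> kernel \<Rightarrow> kernel \<Rightarrow> kernel \<Rightarrow> real" where
  "cycle_at i j k l f g h m =
    (\<integral>\<omega>. f (\<omega> i, \<omega> j) * g (\<omega> i, \<omega> k) * h (\<omega> j, \<omega> l) * m (\<omega> k, \<omega> l) \<partial>copies P)"

text \<open>Opposite edges share no vertex. Thus \<open>f * m\<close> and \<open>g * h\<close> are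
  products of independent factors, hence square integrable, and one application of Cauchy-Schwarz to
  these two products gives both claims.\<close>

lemma
  assumes d: "distinct [i, j, k, l]" "set [i, j, k, l] \<subseteq> {1..4}"
    and sq: "sq_int f" "sq_int g" "sq_int h" "sq_int m"
  shows integrable_cycle: "integrable (copies P)
      (\<lambda>\<omega>. f (\<omega> i, \<omega> j) * g (\<omega> i, \<omega> k) * h (\<omega> j, \<omega> l) * m (\<omega> k, \<omega> l))" (is ?I)
    and cycle_at_power2_le: "(cycle_at i j k l f g h m)\<^sup>2
      \<le> (\<integral>z. (f z)\<^sup>2 \<partial>P2) * (\<integral>z. (m z)\<^sup>2 \<partial>P2) * ((\<integral>z. (g z)\<^sup>2 \<partial>P2) * (\<integral>z. (h z)\<^sup>2 \<partial>P2))" (is ?B)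
proof -
  note [measurable] = sq[THEN sq_int_measurable]
  have [measurable]: "copy i \<in> copies P \<rightarrow>\<^sub>M P" "copy j \<in> copies P \<rightarrow>\<^sub>M P"
      "copy k \<in> copies P \<rightarrow>\<^sub>M P" "copy l \<in> copies P \<rightarrow>\<^sub>M P"
    using d by auto
  have d': "distinct [i, k, j, l]" "set [i, k, j, l] \<subseteq> {1..4}"
    using d by auto
  note fm = integrable_copies_mult[OF d sq_intD[OF sq(1)] sq_intD[OF sq(4)]]
    integral_copies_mult[OF d sq_intD[OF sq(1)] sq_intD[OF sq(4)]]
  note gh = integrable_copies_mult[OF d' sq_intD[OF sq(2)] sq_intD[OF sq(3)]]
    integral_copies_mult[OF d' sq_intD[OF sq(2)] sq_intD[OF sq(3)]]
  let ?F = "\<lambda>\<omega>. f (\<omega> i, \<omega> j) * m (\<omega> k, \<omega> l)"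
  let ?G = "\<lambda>\<omega>. g (\<omega> i, \<omega> k) * h (\<omega> j, \<omega> l)"
  have "(\<lambda>\<omega>. f (\<omega> i, \<omega> j) * g (\<omega> i, \<omega> k) * h (\<omega> j, \<omega> l) * m (\<omega> k, \<omega> l)) = (\<lambda>\<omega>. ?F \<omega> * ?G \<omega>)"
    by (auto simp: mult_ac)
  then show ?I ?B
    using Cauchy_Schwarz_integral[of ?F "copies P" ?G] fm gh
    by (simp_all add: cycle_at_def power_mult_distrib)
qed

lemma abs_cycle_at_le:
  assumes d: "distinct [i, j, k, l]" "set [i, j, k, l] \<subseteq> {1..4}"
    and sq: "sq_int f" "sq_int g" "sq_int h" "sq_int m"
    and le: "(\<integral>z. (f z)\<^sup>2 \<partial>P2) \<le> \<alpha>\<^sup>2" "(\<integral>z. (g z)\<^sup>2 \<partial>P2) \<le> \<beta>\<^sup>2"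
      "(\<integral>z. (h z)\<^sup>2 \<partial>P2) \<le> \<gamma>\<^sup>2" "(\<integral>z. (m z)\<^sup>2 \<partial>P2) \<le> \<delta>\<^sup>2"
    and "0 \<le> \<alpha>" "0 \<le> \<beta>" "0 \<le> \<gamma>" "0 \<le> \<delta>"
  shows "\<bar>cycle_at i j k l f g h m\<bar> \<le> \<alpha> * \<beta> * \<gamma> * \<delta>"
proof (rule power2_le_imp_le)
  have "(cycle_at i j k l f g h m)\<^sup>2 \<le> (\<alpha>\<^sup>2 * \<delta>\<^sup>2) * (\<beta>\<^sup>2 * \<gamma>\<^sup>2)"
    by (rule order_trans[OF cycle_at_power2_le[OF d sq]], intro mult_mono le mult_nonneg_nonneg
        Bochner_Integration.integral_nonneg) auto
  then show "\<bar>cycle_at i j k l f g h m\<bar>\<^sup>2 \<le> (\<alpha> * \<beta> * \<gamma> * \<delta>)\<^sup>2"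
    by (simp add: power_mult_distrib mult_ac)
qed (use assms in auto)

lemma
  assumes d: "distinct [i, j, k, l]" "set [i, j, k, l] \<subseteq> {1..4}"
    and sq: "sq_int f" "sq_int g" "sq_int h" "sq_int m"
  shows cycle_at_add1: "sq_int f' \<Longrightarrow> cycle_at i j k l (\<lambda>z. f z + f' z) g h m
      = cycle_at i j k l f g h m + cycle_at i j k l f' g h m"
    and cycle_at_add2: "sq_int g' \<Longrightarrow> cycle_at i j k l f (\<lambda>z. g z + g' z) h m
      = cycle_at i j k l f g h m + cycle_at i j k l f g' h m"
    and cycle_at_add3: "sq_int h' \<Longrightarrow> cycle_at i j k l f g (\<lambda>z. h z + h' z) m
      = cycle_at i j k l f g h m + cycle_at i j k l f g h' m"
    and cycle_at_add4: "sq_int m' \<Longrightarrow> cycle_at i j k l f g h (\<lambda>z. m z + m' z)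
      = cycle_at i j k l f g h m + cycle_at i j k l f g h m'"
  unfolding cycle_at_def
  by (subst Bochner_Integration.integral_add[symmetric],
      (intro integrable_cycle[OF d] sq; assumption), (intro integrable_cycle[OF d] sq; assumption),
      intro Bochner_Integration.integral_cong refl, simp only: ring_distribs)+

lemma integral_component:
  fixes u :: "(nat \<Rightarrow> real) \<Rightarrow> real"
  assumes [measurable]: "u \<in> borel_measurable P"
  shows "integrable P2 (\<lambda>z. u (fst z)) \<longleftrightarrow> integrable P u"
    "(\<integral>z. u (fst z) \<partial>P2) = integral\<^sup>L P u"
    "integrable P2 (\<lambda>z. u (snd z)) \<longleftrightarrow> integrable P u"
    "(\<integral>z. u (snd z) \<partial>P2) = integral\<^sup>L P u"
proof -
  have 1: "distr P2 P fst = P"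
    by (rule distr_pair_fst)
  have "distr P2 P snd = distr (distr P2 P2 (\<lambda>(x, y). (y, x))) P snd"
    by (simp flip: pair.distr_pair_swap)
  also have "\<dots> = distr P2 P fst"
    by (subst distr_distr) (auto simp: o_def case_prod_unfold)
  finally have 2: "distr P2 P snd = P"
    by (simp add: 1)
  show "integrable P2 (\<lambda>z. u (fst z)) \<longleftrightarrow> integrable P u"
    using integrable_distr_eq[of fst P2 P u] by (simp add: 1)
  show "integrable P2 (\<lambda>z. u (snd z)) \<longleftrightarrow> integrable P u"
    using integrable_distr_eq[of snd P2 P u] by (simp add: 2)
  show "(\<integral>z. u (fst z) \<partial>P2) = integral\<^sup>L P u"
    using integral_distr[of fst P2 P u] by (simp add: 1)
  show "(\<integral>z. u (snd z) \<partial>P2) = integral\<^sup>L P u"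
    using integral_distr[of snd P2 P u] by (simp add: 2)
qed

text \<open>Integrating out the vertex \<open>j\<close> first kills the product, since \<open>a\<close> is centred.\<close>

lemma cycle_at_fst_eq_0:
  assumes d: "distinct [i, j, k, l]" "set [i, j, k, l] \<subseteq> {1..4}"
    and a: "sq_int a" and sym: "\<And>x y. a (x, y) = a (y, x)"
    and cent: "\<And>x. x \<in> space P \<Longrightarrow> (\<integral>y. a (x, y) \<partial>P) = 0"
    and [measurable]: "u \<in> borel_measurable P" and u: "sq_int (\<lambda>z. u (fst z))"
  shows "cycle_at i j k l (\<lambda>z. u (fst z)) a a a = 0"
proof -
  note [measurable] = a[THEN sq_int_measurable]
  let ?F = "\<lambda>p. u (fst (fst p)) * a (fst p) * (a (snd (fst p), fst (snd p)) * a (snd p))"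
  \<comment> \<open>This order groups the vertices as \<open>(i, k)\<close> and
    \<open>(l, j)\<close>: the vertex \<open>j\<close> comes last and, after one use of symmetry,
    occurs only in the factor \<open>a (\<omega> l, \<omega> j)\<close>.\<close>
  have d': "distinct [i, k, l, j]" "set [i, k, l, j] \<subseteq> {1..4}"
    using d by auto
  have eq: "u (fst (\<omega> i, \<omega> j)) * a (\<omega> i, \<omega> k) * a (\<omega> j, \<omega> l) * a (\<omega> k, \<omega> l)
      = ?F ((\<omega> i, \<omega> k), (\<omega> l, \<omega> j))" for \<omega>
    using sym[of "\<omega> j" "\<omega> l"] by simp
  have F: "integrable (P2 \<Otimes>\<^sub>M P2) ?F"
    using integrable_cycle[OF d u a a a]
      integrable_four_copies_iff[OF d', of ?F]
    unfolding eq by simp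
  \<comment> \<open>A slice that is not integrable is no exception: its Bochner integral is 0 by
    convention, so the identity holds for every \<open>z\<close> and not just for almost every
    one.\<close>
  have inner: "(\<integral>(w, y). a (z, w) * a (w, y) \<partial>P2) = 0" for z
  proof (cases "integrable P2 (\<lambda>(w, y). a (z, w) * a (w, y))")
    case True
    show ?thesis
      unfolding pair.integral_fst'[OF True, symmetric]
      by (subst Bochner_Integration.integral_cong[where g = "\<lambda>_. 0"]) (auto simp: cent)
  qed (simp add: not_integrable_integral_eq)
  have "cycle_at i j k l (\<lambda>z. u (fst z)) a a a = integral\<^sup>L (P2 \<Otimes>\<^sub>M P2) ?F"
    using integral_four_copies[OF d', of ?F] unfolding cycle_at_def eq by simp
  also have "\<dots> = (\<integral>s. (\<integral>t. ?F (s, t) \<partial>P2) \<partial>P2)"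
    by (rule pair2.integral_fst'[OF F, symmetric])
  also have "\<dots> = (\<integral>s. 0 \<partial>P2)"
    using inner by (intro Bochner_Integration.integral_cong) (auto simp: case_prod_unfold)
  finally show ?thesis
    by simp
qed

subsection \<open>Perturbation of a centred kernel\<close>

definition row_mean :: "((nat \<Rightarrow> real) \<times> (nat \<Rightarrow> real) \<Rightarrow> real) \<Rightarrow> (nat \<Rightarrow> real) \<Rightarrow> real" where
  "row_mean f x = (\<integral>y. f (x, y) \<partial>P)"

lemma row_mean_measurable [measurable]:
  assumes [measurable]: "f \<in> borel_measurable P2"
  shows "row_mean f \<in> borel_measurable P"
  unfolding row_mean_def by measurable

text \<open>Row means serve for both arguments. This is double centring in the usual sense for
  symmetric kernels, such as the distance and its remainder.\<close>

definition double_centred ::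
    "((nat \<Rightarrow> real) \<times> (nat \<Rightarrow> real) \<Rightarrow> real) \<Rightarrow> (nat \<Rightarrow> real) \<times> (nat \<Rightarrow> real) \<Rightarrow> real" where
  "double_centred f z = f z - row_mean f (fst z) - row_mean f (snd z) + integral\<^sup>L P2 f"

lemma sq_int_integrable:
  assumes "sq_int f"
  shows "integrable P2 f" "(integral\<^sup>L P2 f)\<^sup>2 \<le> (\<integral>z. (f z)\<^sup>2 \<partial>P2)"
  using assms Cauchy_Schwarz_integral[of f P2 "\<lambda>_. 1"]
  by (simp_all add: sq_int_def pair.prob_space)

text \<open>Jensen's inequality for the square, obtained as Cauchy-Schwarz against the constant 1 in
  each section. The sections are square integrable only for almost every \<open>x\<close>, hence the
  detour through \<open>AE\<close>.\<close>

lemma row_mean_power2: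
  assumes "sq_int f"
  shows "integrable P (\<lambda>x. (row_mean f x)\<^sup>2)"
    and "(\<integral>x. (row_mean f x)\<^sup>2 \<partial>P) \<le> (\<integral>z. (f z)\<^sup>2 \<partial>P2)"
proof -
  note [measurable] = assms[THEN sq_int_measurable]
  note sq = sq_intD[OF assms]
  have AE: "AE x in P. (row_mean f x)\<^sup>2 \<le> (\<integral>y. (f (x, y))\<^sup>2 \<partial>P)"
    using pair.AE_integrable_fst'[OF sq] AE_space
  proof eventually_elim
    case (elim x)
    then show ?case
      using Cauchy_Schwarz_integral(2)[of "\<lambda>y. f (x, y)" P "\<lambda>_. 1"]
      by (simp add: row_mean_def prob_space)
  qed
  show i: "integrable P (\<lambda>x. (row_mean f x)\<^sup>2)"
    by (rule Bochner_Integration.integrable_bound[OF pair.integrable_fst'[OF sq]])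
      (use AE in auto)
  show "(\<integral>x. (row_mean f x)\<^sup>2 \<partial>P) \<le> (\<integral>z. (f z)\<^sup>2 \<partial>P2)"
    unfolding pair.integral_fst'[OF sq, symmetric]
    by (rule integral_mono_AE[OF i pair.integrable_fst'[OF sq] AE])
qed

lemma sq_int_row_mean:
  assumes "sq_int f"
  shows "sq_int (\<lambda>z. row_mean f (fst z))" "sq_int (\<lambda>z. row_mean f (snd z))"
  using assms[THEN sq_int_measurable] row_mean_power2(1)[OF assms]
    integral_component(1,3)[of "\<lambda>x. (row_mean f x)\<^sup>2"]
  by (simp_all add: sq_int_def)

lemma sq_int_const: "sq_int (\<lambda>_. c)"
  by (simp add: sq_int_def)

lemma double_centred_decomp:
  "double_centred f = (\<lambda>z. (f z + - row_mean f (fst z)) + (- row_mean f (snd z) + integral\<^sup>L P2 f))"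
  by (auto simp: double_centred_def)

lemma sq_int_double_centred:
  assumes "sq_int f"
  shows "sq_int (double_centred f)"
  unfolding double_centred_decomp
  by (intro sq_int_add sq_int_uminus assms sq_int_row_mean sq_int_const)

lemma double_centred_power2:
  assumes "sq_int f"
  shows "(\<integral>z. (double_centred f z)\<^sup>2 \<partial>P2) \<le> 16 * (\<integral>z. (f z)\<^sup>2 \<partial>P2)"
proof -
  note [measurable] = assms[THEN sq_int_measurable]
  note i = sq_intD[OF assms] sq_int_row_mean[OF assms, THEN sq_intD]
  \<comment> \<open>The difference of the two sides is a sum of squares over the six pairs of
    variables. The 16 of the lemma is this 4 times the four summands, each with mean square at most
    that of \<open>f\<close>.\<close>
  have four: "(s - t - u + w)\<^sup>2 \<le> 4 * (s\<^sup>2 + t\<^sup>2 + u\<^sup>2 + w\<^sup>2)" for s t u w :: real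
  proof -
    have "4 * (s\<^sup>2 + t\<^sup>2 + u\<^sup>2 + w\<^sup>2) - (s - t - u + w)\<^sup>2
       = (s + t)\<^sup>2 + (s + u)\<^sup>2 + (s - w)\<^sup>2 + (t - u)\<^sup>2 + (t + w)\<^sup>2 + (u + w)\<^sup>2"
      by (simp add: power2_eq_square algebra_simps)
    then show ?thesis
      by (smt (verit) zero_le_power2)
  qed
  have "(\<integral>z. (double_centred f z)\<^sup>2 \<partial>P2) \<le> (\<integral>z. 4 * ((f z)\<^sup>2 + (row_mean f (fst z))\<^sup>2
      + (row_mean f (snd z))\<^sup>2 + (integral\<^sup>L P2 f)\<^sup>2) \<partial>P2)"
    using i sq_int_double_centred[OF assms, THEN sq_intD]
    by (intro integral_mono, unfold double_centred_def) (auto simp del: distrib_left_numeral intro: four)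
  also have "\<dots> = 4 * ((\<integral>z. (f z)\<^sup>2 \<partial>P2) + (\<integral>x. (row_mean f x)\<^sup>2 \<partial>P)
      + (\<integral>x. (row_mean f x)\<^sup>2 \<partial>P) + (integral\<^sup>L P2 f)\<^sup>2)"
    using i integral_component(2,4)[of "\<lambda>x. (row_mean f x)\<^sup>2"]
    by (simp add: pair.prob_space)
  also have "\<dots> \<le> 16 * (\<integral>z. (f z)\<^sup>2 \<partial>P2)"
    using row_mean_power2(2)[OF assms] sq_int_integrable(2)[OF assms] by simp
  finally show ?thesis .
qed

text \<open>Each term that the centring adds depends on at most one endpoint of the first edge. It
  vanishes by \<open>cycle_at_fst_eq_0\<close>: directly for the first endpoint and for the
  constant, after a reflection of the cycle for the second endpoint.\<close>

lemma cycle_at_double_centred: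
  assumes d: "distinct [i, j, k, l]" "set [i, j, k, l] \<subseteq> {1..4}"
    and a: "sq_int a" and sym: "\<And>x y. a (x, y) = a (y, x)"
    and cent: "\<And>x. x \<in> space P \<Longrightarrow> (\<integral>y. a (x, y) \<partial>P) = 0"
    and f: "sq_int f"
  shows "cycle_at i j k l (double_centred f) a a a = cycle_at i j k l f a a a"
proof -
  note [measurable] = f[THEN sq_int_measurable]
  note r = sq_int_row_mean[OF f]
  have fst: "cycle_at i j k l (\<lambda>z. u (fst z)) a a a = 0"
    if "u \<in> borel_measurable P" "sq_int (\<lambda>z. u (fst z))" for u
    using cycle_at_fst_eq_0[OF d a sym cent] that by auto
  have snd: "cycle_at i j k l (\<lambda>z. u (snd z)) a a a = 0"
    if "u \<in> borel_measurable P" "sq_int (\<lambda>z. u (fst z))" for u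
  proof -
    \<comment> \<open>The reflection exchanges \<open>i\<close> with \<open>j\<close> and
      \<open>k\<close> with \<open>l\<close>. The two middle factors trade places, and symmetry of
      \<open>a\<close> absorbs the reversal of the last edge.\<close>
    have "cycle_at i j k l (\<lambda>z. u (snd z)) a a a = cycle_at j i l k (\<lambda>z. u (fst z)) a a a"
      unfolding cycle_at_def
      by (intro Bochner_Integration.integral_cong refl) (simp add: sym mult_ac)
    also have "\<dots> = 0"
      using d that by (intro cycle_at_fst_eq_0 a sym cent) auto
    finally show ?thesis .
  qed
  note i = sq_int_add sq_int_uminus f r sq_int_const
  have "cycle_at i j k l (\<lambda>z. (- row_mean f) (fst z)) a a a = 0"
    "cycle_at i j k l (\<lambda>z. (- row_mean f) (snd z)) a a a = 0"
    "cycle_at i j k l (\<lambda>_. integral\<^sup>L P2 f) a a a = 0"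
    using i(2)[OF r(1)] fst[of "\<lambda>_. integral\<^sup>L P2 f"]
    by (auto intro!: fst snd sq_int_const simp: fun_Compl_def)
  moreover have "cycle_at i j k l (double_centred f) a a a = cycle_at i j k l f a a a
      + cycle_at i j k l (\<lambda>z. - row_mean f (fst z)) a a a
      + (cycle_at i j k l (\<lambda>z. - row_mean f (snd z)) a a a
        + cycle_at i j k l (\<lambda>_. integral\<^sup>L P2 f) a a a)"
    unfolding double_centred_decomp
    by (simp only: cycle_at_add1[OF d _ a a a] i)
  ultimately show ?thesis
    by simp
qed

text \<open>The factor \<open>a\<close> opposite to \<open>f\<close> is grouped with
  \<open>v powr (s - 1)\<close>, the two adjacent factors form the other group. Moments of order
  \<open>s\<close> suffice because the exponent \<open>r\<close> conjugate to \<open>s\<close> is at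
  most \<open>s\<close> when \<open>2 \<le> s\<close>. In the bound, \<open>2 * K\<close> comes from
  \<open>v\<close> and the opposite factor, whose moment of order \<open>r\<close> is at most 2, and
  1 from the adjacent factors.\<close>

lemma abs_cycle_at_interpolated_le:
  assumes d: "distinct [i, j, k, l]" "set [i, j, k, l] \<subseteq> {1..4}"
    and a: "sq_int a" and f: "sq_int f" and [measurable]: "v \<in> borel_measurable P2"
    and s: "2 \<le> s" and "0 \<le> c" and v0: "\<And>z. 0 \<le> v z"
    and fv: "\<And>z. z \<in> space P2 \<Longrightarrow> \<bar>f z\<bar> \<le> c * v z powr (s - 1)"
    and ia: "integrable P2 (\<lambda>z. \<bar>a z\<bar> powr s)" "(\<integral>z. \<bar>a z\<bar> powr s \<partial>P2) \<le> 1"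
    and iv: "integrable P2 (\<lambda>z. v z powr s)" "(\<integral>z. v z powr s \<partial>P2) \<le> K"
  shows "\<bar>cycle_at i j k l f a a a\<bar> \<le> c * (2 * K + 1)"
proof -
  note [measurable] = a[THEN sq_int_measurable]
  have d': "distinct [i, k, j, l]" "set [i, k, j, l] \<subseteq> {1..4}"
    using d by auto
  define r where "r = s / (s - 1)"
  have r: "0 \<le> r" "r \<le> s"
    using s by (auto simp: r_def field_simps)
  have ir: "integrable P2 (\<lambda>z. \<bar>a z\<bar> powr r)" and "(\<integral>z. \<bar>a z\<bar> powr r \<partial>P2) \<le> 1 + (\<integral>z. \<bar>a z\<bar> powr s \<partial>P2)"
    by (intro pair.integrable_le_one_plus[OF _ ia(1)] pair.integral_le_one_plus[OF _ ia(1)];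
        simp add: powr_le_one_plus_powr[OF _ r])+
  then have ar2: "(\<integral>z. \<bar>a z\<bar> powr r \<partial>P2) \<le> 2"
    using ia(2) by simp
  let ?D = "\<lambda>\<omega>. c * (v (\<omega> i, \<omega> j) powr s * \<bar>a (\<omega> k, \<omega> l)\<bar> powr r
      + \<bar>a (\<omega> i, \<omega> k)\<bar> powr s * \<bar>a (\<omega> j, \<omega> l)\<bar> powr s)"
  note i1 = integrable_copies_mult[OF d iv(1) ir] integral_copies_mult[OF d iv(1) ir]
  note i2 = integrable_copies_mult[OF d' ia(1) ia(1)] integral_copies_mult[OF d' ia(1) ia(1)]
  have D: "integrable (copies P) ?D"
    using i1 i2 by simp
  have "\<bar>cycle_at i j k l f a a a\<bar>
      \<le> (\<integral>\<omega>. \<bar>f (\<omega> i, \<omega> j) * a (\<omega> i, \<omega> k) * a (\<omega> j, \<omega> l) * a (\<omega> k, \<omega> l)\<bar> \<partial>copies P)"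
    unfolding cycle_at_def by (rule integral_abs_bound)
  also have "\<dots> \<le> integral\<^sup>L (copies P) ?D"
  proof (rule integral_mono[OF integrable_abs[OF integrable_cycle[OF d f a a a]] D])
    fix \<omega> assume \<omega>: "\<omega> \<in> space (copies P)"
    have z: "(\<omega> i, \<omega> j) \<in> space P2"
      using \<omega> d by (auto simp: space_pair_measure space_PiM)
    \<comment> \<open>The exponent \<open>1 / (s - 1)\<close> makes \<open>w powr (s - 1)\<close>
      reproduce \<open>v powr (s - 1)\<close> times the first power of the opposite factor, while
      \<open>w powr s\<close> raises that factor only to the power \<open>r\<close>.\<close>
    define w where "w = v (\<omega> i, \<omega> j) * \<bar>a (\<omega> k, \<omega> l)\<bar> powr (1 / (s - 1))"
    define e where "e = \<bar>a (\<omega> i, \<omega> k)\<bar> * \<bar>a (\<omega> j, \<omega> l)\<bar>"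
    have "\<bar>f (\<omega> i, \<omega> j) * a (\<omega> i, \<omega> k) * a (\<omega> j, \<omega> l) * a (\<omega> k, \<omega> l)\<bar>
        = \<bar>f (\<omega> i, \<omega> j)\<bar> * (e * \<bar>a (\<omega> k, \<omega> l)\<bar>)"
      by (simp add: abs_mult e_def mult_ac)
    also have "\<dots> \<le> (c * v (\<omega> i, \<omega> j) powr (s - 1)) * (e * \<bar>a (\<omega> k, \<omega> l)\<bar>)"
      by (intro mult_right_mono fv z) (auto simp: e_def)
    also have "\<dots> = c * (w powr (s - 1) * e)"
      using s by (simp add: w_def powr_mult powr_powr mult_ac v0)
    also have "\<dots> \<le> c * (w powr s + e powr s)"
      using \<open>0 \<le> c\<close> s v0 by (intro mult_left_mono powr_mult_le_add_powr) (auto simp: w_def e_def)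
    also have "\<dots> = ?D \<omega>"
      using s by (simp add: w_def e_def powr_mult powr_powr r_def v0)
    finally show "\<bar>f (\<omega> i, \<omega> j) * a (\<omega> i, \<omega> k) * a (\<omega> j, \<omega> l) * a (\<omega> k, \<omega> l)\<bar> \<le> ?D \<omega>" .
  qed
  also have "\<dots> = c * ((\<integral>z. v z powr s \<partial>P2) * (\<integral>z. \<bar>a z\<bar> powr r \<partial>P2)
      + (\<integral>z. \<bar>a z\<bar> powr s \<partial>P2) * (\<integral>z. \<bar>a z\<bar> powr s \<partial>P2))"
    using i1 i2 by simp
  also have "\<dots> \<le> c * (K * 2 + 1 * 1)"
  proof (intro mult_left_mono add_mono mult_mono iv(2) ar2 ia(2) \<open>0 \<le> c\<close>)
    have "0 \<le> (\<integral>z. v z powr s \<partial>P2)"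
      by (intro Bochner_Integration.integral_nonneg) auto
    then show "0 \<le> K"
      using iv(2) by (rule order_trans)
  qed (auto intro!: Bochner_Integration.integral_nonneg)
  finally show ?thesis
    by (simp add: mult_ac)
qed

text \<open>Multilinear expansion gives 16 terms: the unperturbed one, four with a single centred
  remainder, eleven with at least two. The bounds 1 and 128 in the hypotheses are those that
  \<open>a\<close> and \<open>v\<close> satisfy after normalisation by \<open>r\<close>; they are
  what makes the constant absolute.\<close>

lemma abs_cycle_perturbation_le:
  fixes \<epsilon> \<tau> :: real
  assumes \<tau>: "0 < \<tau>" "\<tau> \<le> 1 / 2" and "0 \<le> \<epsilon>"
    and [measurable]: "a \<in> borel_measurable P2" "q \<in> borel_measurable P2" "v \<in> borel_measurable P2"
    and sym: "\<And>x y. a (x, y) = a (y, x)"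
    and cent: "\<And>x. x \<in> space P \<Longrightarrow> (\<integral>y. a (x, y) \<partial>P) = 0"
    and ia: "integrable P2 (\<lambda>z. \<bar>a z\<bar> powr (2 + 2 * \<tau>))"
      "(\<integral>z. \<bar>a z\<bar> powr (2 + 2 * \<tau>) \<partial>P2) \<le> 1"
    and iv: "integrable P2 (\<lambda>z. v z powr (2 + 2 * \<tau>))" "(\<integral>z. v z powr (2 + 2 * \<tau>) \<partial>P2) \<le> 128"
    and q: "\<And>z. 0 \<le> q z" "\<And>z. q z \<le> v z" "\<And>z. q z \<le> \<epsilon> * (v z)\<^sup>2"
  shows "\<bar>cycle_at 1 2 3 4 (\<lambda>z. a z + double_centred q z) (\<lambda>z. a z + double_centred q z)
        (\<lambda>z. a z + double_centred q z) (\<lambda>z. a z + double_centred q z)\<bar>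
      \<le> \<bar>cycle_at 1 2 3 4 a a a a\<bar> + 10 ^ 7 * \<epsilon> powr (2 * \<tau>)"
proof -
  define s where "s = 2 + 2 * \<tau>"
  define e where "e = \<epsilon> powr (2 * \<tau>)"
  have s: "2 \<le> s"
    using \<tau> by (simp add: s_def)
  have e0: "0 \<le> e"
    by (simp add: e_def)
  note ia = ia[folded s_def] and iv = iv[folded s_def]
  have v0: "0 \<le> v z" for z
    using q(1,2)[of z] by simp
  have "integrable P2 (\<lambda>z. (a z)\<^sup>2)" and "(\<integral>z. (a z)\<^sup>2 \<partial>P2) \<le> 1 + (\<integral>z. \<bar>a z\<bar> powr s \<partial>P2)"
    by (intro pair.integrable_le_one_plus[OF _ ia(1)] pair.integral_le_one_plus[OF _ ia(1)];
        simp add: power2_le_one_plus_powr[OF s])+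
  then have a: "sq_int a" and a2: "(\<integral>z. (a z)\<^sup>2 \<partial>P2) \<le> 2\<^sup>2"
    using ia(2) by (auto simp: sq_int_def)
  have q2v: "(q z)\<^sup>2 \<le> 1 + v z powr s" for z
    using power2_le_one_plus_powr[OF s, of "v z"] power_mono[OF q(2) q(1), of z 2] v0[of z] by simp
  have "integrable P2 (\<lambda>z. (q z)\<^sup>2)" and "(\<integral>z. (q z)\<^sup>2 \<partial>P2) \<le> 1 + (\<integral>z. v z powr s \<partial>P2)"
    by (intro pair.integrable_le_one_plus[OF _ iv(1)] pair.integral_le_one_plus[OF _ iv(1)];
        simp add: q2v)+
  then have sq: "sq_int q" and q129: "(\<integral>z. (q z)\<^sup>2 \<partial>P2) \<le> 129"
    using iv(2) by (auto simp: sq_int_def)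
  have q2e: "(q z)\<^sup>2 \<le> e * v z powr s" for z
  proof -
    have "(q z)\<^sup>2 \<le> (\<epsilon> powr \<tau> * v z powr (1 + \<tau>))\<^sup>2"
      using interpolated_bound[OF q \<open>0 \<le> \<epsilon>\<close>, of \<tau>] \<tau> q(1)[of z] by (intro power_mono) auto
    also have "\<dots> = (\<epsilon> powr \<tau>)\<^sup>2 * (v z powr (1 + \<tau>))\<^sup>2"
      by (rule power_mult_distrib)
    also have "\<dots> = e * v z powr s"
      by (simp add: e_def s_def power2_eq_square flip: powr_add)
    finally show ?thesis .
  qed
  have "(\<integral>z. (q z)\<^sup>2 \<partial>P2) \<le> (\<integral>z. e * v z powr s \<partial>P2)"
    using sq iv by (intro integral_mono q2e) (auto simp: sq_int_def)
  also have "\<dots> \<le> e * 128"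
    using iv e0 by (simp add: mult_left_mono)
  finally have qe: "(\<integral>z. (q z)\<^sup>2 \<partial>P2) \<le> 128 * e"
    by simp
  define b where "b = double_centred q"
  have b: "sq_int b"
    unfolding b_def by (rule sq_int_double_centred[OF sq])
  define \<rho> where "\<rho> = sqrt (\<integral>z. (b z)\<^sup>2 \<partial>P2)"
  have b0: "0 \<le> (\<integral>z. (b z)\<^sup>2 \<partial>P2)"
    by (rule Bochner_Integration.integral_nonneg) simp
  have \<rho>: "0 \<le> \<rho>" "\<rho>\<^sup>2 = (\<integral>z. (b z)\<^sup>2 \<partial>P2)"
    using b0 by (auto simp: \<rho>_def)
  have b2: "(\<integral>z. (b z)\<^sup>2 \<partial>P2) \<le> \<rho>\<^sup>2"
    using \<rho> by simp
  \<comment> \<open>Two bounds on the same norm: 2048 is \<open>16 * 128\<close> and carries the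
    small factor \<open>e\<close>, while \<open>16 * 129\<close> is below the square of 46 and gives
    an absolute bound that reduces third and fourth powers of \<open>\<rho>\<close> to
    \<open>\<rho>\<^sup>2\<close>.\<close>
  have \<rho>e: "\<rho>\<^sup>2 \<le> 2048 * e" and "\<rho>\<^sup>2 \<le> 46\<^sup>2"
    using double_centred_power2[OF sq] qe q129 \<rho>(2) by (auto simp: b_def)
  then have \<rho>46: "\<rho> \<le> 46"
    by (intro power2_le_imp_le[of \<rho> 46]) auto
  have lin: "\<bar>cycle_at i j k l b a a a\<bar> \<le> 257 * e"
    if d: "distinct [i, j, k, l]" "set [i, j, k, l] \<subseteq> {1..4}" for i j k l
  proof -
    have "cycle_at i j k l b a a a = cycle_at i j k l q a a a"
      unfolding b_def by (rule cycle_at_double_centred[OF d a sym cent sq])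
    also have "\<bar>\<dots>\<bar> \<le> e * (2 * 128 + 1)"
    proof (rule abs_cycle_at_interpolated_le[OF d a sq _ s e0 v0 _ ia iv])
      show "\<bar>q z\<bar> \<le> e * v z powr (s - 1)" for z
        using interpolated_bound[OF q \<open>0 \<le> \<epsilon>\<close>, of "2 * \<tau>" z] \<tau> q(1)[of z] by (simp add: e_def s_def)
    qed simp
    finally show ?thesis
      by simp
  qed
  define c where "c = cycle_at 1 2 3 4"
  have d: "distinct [1, 2, 3, 4 :: nat]" "set [1, 2, 3, 4 :: nat] \<subseteq> {1..4}"
    by auto
  note add = cycle_at_add1[OF d, folded c_def] cycle_at_add2[OF d, folded c_def]
    cycle_at_add3[OF d, folded c_def] cycle_at_add4[OF d, folded c_def]
  note bound = abs_cycle_at_le[OF d, folded c_def]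
  \<comment> \<open>Relabelling the cycle moves the edge that carries \<open>b\<close> to the front,
    where \<open>lin\<close> applies for arbitrary labels.\<close>
  have "c a b a a = cycle_at 1 3 2 4 b a a a" "c a a b a = cycle_at 2 4 1 3 b a a a"
    "c a a a b = cycle_at 3 4 1 2 b a a a"
    unfolding c_def cycle_at_def
    by (intro Bochner_Integration.integral_cong refl; simp add: sym mult_ac)+
  then have l: "\<bar>c b a a a\<bar> \<le> 257 * e" "\<bar>c a b a a\<bar> \<le> 257 * e" "\<bar>c a a b a\<bar> \<le> 257 * e"
      "\<bar>c a a a b\<bar> \<le> 257 * e"
    using lin by (auto simp: c_def)
  have two: "\<bar>c b b a a\<bar> \<le> 4 * \<rho>\<^sup>2" "\<bar>c b a b a\<bar> \<le> 4 * \<rho>\<^sup>2" "\<bar>c b a a b\<bar> \<le> 4 * \<rho>\<^sup>2"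
      "\<bar>c a b b a\<bar> \<le> 4 * \<rho>\<^sup>2" "\<bar>c a b a b\<bar> \<le> 4 * \<rho>\<^sup>2" "\<bar>c a a b b\<bar> \<le> 4 * \<rho>\<^sup>2"
    using bound[OF b b a a b2 b2 a2 a2] bound[OF b a b a b2 a2 b2 a2] bound[OF b a a b b2 a2 a2 b2]
      bound[OF a b b a a2 b2 b2 a2] bound[OF a b a b a2 b2 a2 b2] bound[OF a a b b a2 a2 b2 b2] \<rho>(1)
    by (auto simp: power2_eq_square)
  have r3: "2 * \<rho> ^ 3 \<le> 92 * \<rho>\<^sup>2"
    using mult_right_mono[OF \<rho>46, of "\<rho>\<^sup>2"] by (simp add: power2_eq_square power3_eq_cube)
  have three: "\<bar>c b b b a\<bar> \<le> 92 * \<rho>\<^sup>2" "\<bar>c b b a b\<bar> \<le> 92 * \<rho>\<^sup>2" "\<bar>c b a b b\<bar> \<le> 92 * \<rho>\<^sup>2"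
      "\<bar>c a b b b\<bar> \<le> 92 * \<rho>\<^sup>2"
    using bound[OF b b b a b2 b2 b2 a2] bound[OF b b a b b2 b2 a2 b2] bound[OF b a b b b2 a2 b2 b2]
      bound[OF a b b b a2 b2 b2 b2] \<rho>(1) r3
    by (auto simp: power3_eq_cube mult_ac)
  have four: "\<bar>c b b b b\<bar> \<le> 2116 * \<rho>\<^sup>2"
  proof -
    have "\<bar>c b b b b\<bar> \<le> \<rho>\<^sup>2 * \<rho>\<^sup>2"
      using bound[OF b b b b b2 b2 b2 b2] \<rho>(1) by (simp add: power2_eq_square mult_ac)
    also have "\<dots> \<le> 46\<^sup>2 * \<rho>\<^sup>2"
      using \<open>\<rho>\<^sup>2 \<le> 46\<^sup>2\<close> by (intro mult_right_mono) auto
    finally show ?thesis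
      by simp
  qed
  let ?K = "\<lambda>z. a z + b z"
  have K: "sq_int ?K"
    by (intro sq_int_add a b)
  have "c ?K ?K ?K ?K = c a a a a + (c b a a a + c a b a a + c a a b a + c a a a b)
      + (c b b a a + c b a b a + c b a a b + c a b b a + c a b a b + c a a b b)
      + (c b b b a + c b b a b + c b a b b + c a b b b) + c b b b b"
    by (simp add: add a b K)
  moreover obtain w where w: "w = \<bar>c a a a a\<bar>"
    by simp
  from w have "c a a a a \<le> w" "- c a a a a \<le> w"
    by auto
  ultimately have "c ?K ?K ?K ?K \<le> w + 4 * (257 * e) + 6 * (4 * \<rho>\<^sup>2)
        + 4 * (92 * \<rho>\<^sup>2) + 2116 * \<rho>\<^sup>2"
      "- c ?K ?K ?K ?K \<le> w + 4 * (257 * e) + 6 * (4 * \<rho>\<^sup>2)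
        + 4 * (92 * \<rho>\<^sup>2) + 2116 * \<rho>\<^sup>2"
    using l[THEN abs_le_D1] two[THEN abs_le_D1] three[THEN abs_le_D1] four[THEN abs_le_D1]
      l[THEN abs_le_D2] two[THEN abs_le_D2] three[THEN abs_le_D2] four[THEN abs_le_D2]
    by linarith+
  then have "\<bar>c ?K ?K ?K ?K\<bar> \<le> \<bar>c a a a a\<bar> + 4 * (257 * e) + 6 * (4 * \<rho>\<^sup>2)
      + 4 * (92 * \<rho>\<^sup>2) + 2116 * \<rho>\<^sup>2"
    unfolding w by (rule abs_leI)
  \<comment> \<open>The exact count is \<open>4 * 257 + (6 * 4 + 4 * 92 + 2116) * 2048\<close>,
    about 5.1 million, rounded up.\<close>
  also have "\<dots> \<le> \<bar>c a a a a\<bar> + 10 ^ 7 * e"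
    using \<rho>e e0 by simp
  finally show ?thesis
    by (simp add: c_def b_def e_def)
qed

text \<open>With the opposite vertices 1 and 4 fixed, vertices 2 and 3 are independent and enter
  through the same two-step path, so integrating them out yields a square. Only the law of the
  remaining pair matters, which allows vertex 4 to be renamed 2.\<close>

lemma cycle_at_eq_integral_power2:
  assumes a: "sq_int a" and sym: "\<And>x y. a (x, y) = a (y, x)"
    and int: "\<And>x y. x \<in> space P \<Longrightarrow> y \<in> space P \<Longrightarrow> integrable P (\<lambda>z. a (x, z) * a (z, y))"
  shows "cycle_at 1 2 3 4 a a a a = (\<integral>\<omega>. (\<integral>z. a (\<omega> 1, z) * a (z, \<omega> 2) \<partial>P)\<^sup>2 \<partial>copies P)"
proof -
  note [measurable] = a[THEN sq_int_measurable]
  let ?F = "\<lambda>p. a (fst (fst p), fst (snd p)) * a (fst (fst p), snd (snd p))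
      * a (fst (snd p), snd (fst p)) * a (snd (snd p), snd (fst p))"
  let ?G = "\<lambda>s. (\<integral>z. a (fst s, z) * a (z, snd s) \<partial>P)\<^sup>2"
  have d: "distinct [1, 2, 3, 4 :: nat]" "set [1, 2, 3, 4 :: nat] \<subseteq> {1..4}"
    and d': "distinct [1, 4, 2, 3 :: nat]" "set [1, 4, 2, 3 :: nat] \<subseteq> {1..4}"
    by auto
  have F: "integrable (P2 \<Otimes>\<^sub>M P2) ?F"
    using integrable_cycle[OF d a a a a] integrable_four_copies_iff[OF d', of ?F] by simp
  have inner: "(\<integral>t. ?F (s, t) \<partial>P2) = ?G s" if s2: "s \<in> space P2" for s
  proof -
    obtain x y where s: "s = (x, y)" and xy: "x \<in> space P" "y \<in> space P"
      using s2 by (auto simp: space_pair_measure)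
    let ?h = "\<lambda>z. a (x, z) * a (z, y)"
    have h: "integrable P ?h"
      by (rule int[OF xy])
    have [measurable]: "?h \<in> borel_measurable P"
      using h by auto
    have hh: "integrable P2 (\<lambda>(w, z). ?h w * ?h z)"
      using h integrable_abs[OF h] by (intro pair.Fubini_integrable) (auto simp: abs_mult)
    have "(\<integral>t. ?F (s, t) \<partial>P2) = (\<integral>(w, z). ?h w * ?h z \<partial>P2)"
      by (intro Bochner_Integration.integral_cong refl) (auto simp: s)
    also have "\<dots> = (\<integral>w. \<integral>z. ?h w * ?h z \<partial>P \<partial>P)"
      using pair.integral_fst'[OF hh] by simp
    also have "\<dots> = ?G s"
      by (simp add: s power2_eq_square)
    finally show ?thesis .
  qed
  have "cycle_at 1 2 3 4 a a a a = integral\<^sup>L (P2 \<Otimes>\<^sub>M P2) ?F"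
    using integral_four_copies[OF d', of ?F] unfolding cycle_at_def by simp
  also have "\<dots> = (\<integral>s. (\<integral>t. ?F (s, t) \<partial>P2) \<partial>P2)"
    by (rule pair2.integral_fst'[OF F, symmetric])
  also have "\<dots> = integral\<^sup>L P2 ?G"
    by (intro Bochner_Integration.integral_cong refl inner)
  also have "\<dots> = (\<integral>\<omega>. ?G (\<omega> 1, \<omega> 2) \<partial>copies P)"
    by (rule integral_two_copies[symmetric]) auto
  finally show ?thesis
    by simp
qed

text \<open>Every set of the generated sigma-algebra is a preimage of some \<open>S\<close> under
  one copy, so testing against it reduces to Fubini for \<open>indicator S x * f (x, y)\<close>.
  Equality is only almost everywhere, since \<open>real_cond_exp\<close> is an unspecified
  version.\<close>

lemma cond_exp_given_copy:
  assumes sets: "sets P = sets (Rvec p)" and ij: "i \<in> {1..4}" "j \<in> {1..4}" "i \<noteq> j"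
    and f: "integrable P2 f"
  shows "AE \<omega> in copies P.
    cond_exp_given (copies P) p (\<lambda>\<omega>. f (\<omega> i, \<omega> j)) (copy i) \<omega> = row_mean f (\<omega> i)"
proof -
  have [measurable]: "f \<in> borel_measurable P2"
    using f by simp
  define F where "F = vimage_algebra (space (copies P)) (copy i) (Rvec p)"
  have meas: "copy i \<in> copies P \<rightarrow>\<^sub>M Rvec p"
    using copy_measurable[OF ij(1)] by (simp add: measurable_cong_sets[OF refl sets])
  have "copy i \<in> space (copies P) \<rightarrow> space (Rvec p)"
    using measurable_space[OF meas] by blast
  note sets_F = sets_vimage_algebra2[OF this, folded F_def]
  have sub: "subalgebra (copies P) F"
    unfolding subalgebra_def sets_F using measurable_sets[OF meas] by (auto simp: F_def)
  interpret finite_measure_subalgebra "copies P" F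
    by unfold_locales (rule sub)
  have [measurable]: "copy i \<in> F \<rightarrow>\<^sub>M P"
    unfolding measurable_cong_sets[OF refl sets] F_def
    using meas by (intro measurable_vimage_algebra1) (auto dest: measurable_space)
  have [measurable]: "copy i \<in> copies P \<rightarrow>\<^sub>M P"
    using ij by simp
  have rm: "integrable P (row_mean f)"
    unfolding row_mean_def by (rule pair.integrable_fst'[OF f])
  have set_int: "(\<integral>\<omega>\<in>A. f (\<omega> i, \<omega> j) \<partial>copies P) = (\<integral>\<omega>\<in>A. row_mean f (\<omega> i) \<partial>copies P)"
    if A_F: "A \<in> sets F" for A
  proof -
    obtain S where [measurable]: "S \<in> sets P" and A: "A = copy i -` S \<inter> space (copies P)"
      using A_F unfolding sets_F sets by auto
    let ?f = "\<lambda>z. indicator S (fst z) * f z" and ?g = "\<lambda>z. indicator S (fst z) * row_mean f (fst z)"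
    have int: "integrable P2 ?f"
      by (rule Bochner_Integration.integrable_bound[OF f]) (auto simp: indicator_def)
    have "(\<integral>\<omega>\<in>A. f (\<omega> i, \<omega> j) \<partial>copies P) = (\<integral>\<omega>. ?f (\<omega> i, \<omega> j) \<partial>copies P)"
      unfolding set_lebesgue_integral_def A
      by (intro Bochner_Integration.integral_cong) (auto simp: indicator_def)
    also have "\<dots> = integral\<^sup>L P2 ?f"
      by (rule integral_two_copies[OF ij]) simp
    also have "\<dots> = (\<integral>x. indicator S x * row_mean f x \<partial>P)"
      unfolding pair.integral_fst'[OF int, symmetric] by (simp add: row_mean_def)
    also have "\<dots> = integral\<^sup>L P2 ?g"
      by (rule integral_component(2)[symmetric]) simp
    also have "\<dots> = (\<integral>\<omega>. ?g (\<omega> i, \<omega> j) \<partial>copies P)"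
      by (rule integral_two_copies[OF ij, symmetric]) simp
    also have "\<dots> = (\<integral>\<omega>\<in>A. row_mean f (\<omega> i) \<partial>copies P)"
      unfolding set_lebesgue_integral_def A
      by (intro Bochner_Integration.integral_cong) (auto simp: indicator_def)
    finally show ?thesis .
  qed
  have "integrable (copies P) (\<lambda>\<omega>. f (\<omega> i, \<omega> j))"
    using f by (simp add: integrable_two_copies_iff[OF ij])
  moreover have "integrable (copies P) (\<lambda>\<omega>. row_mean f (\<omega> i))"
    using integrable_two_copies_iff[OF ij, of "\<lambda>z. row_mean f (fst z)"] integral_component(1)[of "row_mean f"] rm
    by simp
  ultimately show ?thesis
    unfolding cond_exp_given_def F_def[symmetric]
    by (intro real_cond_exp_charact set_int) auto
qed

end

section \<open>The distance kernel of a random vector\<close>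

text \<open>Only second moments are assumed here; the moment of order \<open>4 + 4 * \<tau>\<close>
  is a hypothesis of the individual lemmas that estimate powers.\<close>

locale random_vector = iid_copies P for P +
  fixes p :: nat
  assumes sets_P [measurable_cong]: "sets P = sets (Rvec p)"
    and integrable_norm_power2: "integrable P (\<lambda>x. (vnorm p x)\<^sup>2)"
    and mean_eq_0: "\<And>i. i < p \<Longrightarrow> (\<integral>x. x i \<partial>P) = 0"
begin

section \<open>Measurability and moments of norm, inner product and distance\<close>

lemma coord_measurable [measurable]: "i < p \<Longrightarrow> (\<lambda>x. x i) \<in> borel_measurable P"
  by (subst measurable_cong_sets[OF sets_P refl]) auto

lemma vnorm_power2: "(vnorm p x)\<^sup>2 = (\<Sum>i<p. (x i)\<^sup>2)"
  by (simp add: vnorm_def L2_set_def sum_nonneg)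

lemma vnorm_measurable [measurable]: "vnorm p \<in> borel_measurable P"
proof -
  have "(\<lambda>x. sqrt (\<Sum>i<p. (x i)\<^sup>2)) \<in> borel_measurable P"
    by measurable
  then show ?thesis
    by (simp add: vnorm_def[abs_def] L2_set_def)
qed

lemma vinner_measurable [measurable]: "(\<lambda>z. vinner p (fst z) (snd z)) \<in> borel_measurable P2"
  unfolding vinner_def
  by (intro borel_measurable_sum borel_measurable_times measurable_compose[OF measurable_fst]
    measurable_compose[OF measurable_snd] coord_measurable) auto

lemma vdist_power2: "(vdist p x y)\<^sup>2 = (vnorm p x)\<^sup>2 + (vnorm p y)\<^sup>2 - 2 * vinner p x y"
proof -
  have "(vdist p x y)\<^sup>2 = (\<Sum>i<p. (x i - y i)\<^sup>2)"
    by (simp add: vdist_def vnorm_def L2_set_def sum_nonneg)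
  also have "\<dots> = (\<Sum>i<p. (x i)\<^sup>2 + (y i)\<^sup>2 - 2 * (x i * y i))"
    by (simp add: power2_diff mult.assoc)
  finally show ?thesis
    by (simp add: vnorm_power2 vinner_def sum.distrib sum_subtractf sum_distrib_left)
qed

lemma vdist_nonneg: "0 \<le> vdist p x y"
  by (simp add: vdist_def vnorm_def)

lemma vdist_measurable [measurable]: "(\<lambda>z. vdist p (fst z) (snd z)) \<in> borel_measurable P2"
proof -
  have "vdist p x y = sqrt ((vnorm p x)\<^sup>2 + (vnorm p y)\<^sup>2 - 2 * vinner p x y)" for x y
    using real_sqrt_abs[of "vdist p x y"] vdist_nonneg[of x y] by (simp add: vdist_power2)
  then show ?thesis
    by simp
qed

lemma vnorm_nonneg: "0 \<le> vnorm p x"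
  by (simp add: vnorm_def)

lemma vdist_commute: "vdist p x y = vdist p y x"
  by (simp add: vdist_def vnorm_def L2_set_def power2_commute)

lemma vinner_commute: "vinner p x y = vinner p y x"
  by (simp add: vinner_def mult.commute)

lemma abs_vinner_le: "\<bar>vinner p x y\<bar> \<le> vnorm p x * vnorm p y"
proof -
  have "\<bar>vinner p x y\<bar> \<le> (\<Sum>i<p. \<bar>x i\<bar> * \<bar>y i\<bar>)"
    unfolding vinner_def by (rule order_trans[OF sum_abs]) (simp add: abs_mult)
  also have "\<dots> \<le> vnorm p x * vnorm p y"
    unfolding vnorm_def by (rule L2_set_mult_ineq)
  finally show ?thesis .
qed

lemma integrable_coord_mult:
  assumes "i < p" "j < p"
  shows "integrable P (\<lambda>x. x i * x j)"
proof (rule Cauchy_Schwarz_integral(1))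
  have "integrable P (\<lambda>x. (x i)\<^sup>2)" if "i < p" for i
    by (rule Bochner_Integration.integrable_bound[OF integrable_norm_power2])
      (use that in \<open>auto intro!: AE_I2 member_le_sum simp: vnorm_power2 sum_nonneg\<close>)
  then show "integrable P (\<lambda>x. (x i)\<^sup>2)" "integrable P (\<lambda>x. (x j)\<^sup>2)"
    using assms by auto
qed (use assms in auto)

lemma integrable_coord:
  assumes "i < p"
  shows "integrable P (\<lambda>x. x i)"
  using Cauchy_Schwarz_integral(1)[of "\<lambda>x. x i" P "\<lambda>_. 1"] assms integrable_coord_mult[of i i]
  by (simp add: power2_eq_square)

lemma integrable_vinner: "integrable P (vinner p x)"
  unfolding vinner_def by (auto intro!: integrable_coord)

lemma integral_vinner: "integral\<^sup>L P (vinner p x) = 0"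
  unfolding vinner_def by (subst Bochner_Integration.integral_sum) (auto simp: mean_eq_0 intro!: integrable_coord)

lemma vinner_mult_eq: "vinner p x z * vinner p z y = (\<Sum>i<p. \<Sum>j<p. x i * y j * (z i * z j))"
  by (simp add: vinner_def sum_product mult_ac)

lemma integrable_vinner_mult: "integrable P (\<lambda>z. vinner p x z * vinner p z y)"
  unfolding vinner_mult_eq
  by (intro Bochner_Integration.integrable_sum integrable_mult_right integrable_coord_mult) auto

text \<open>The two-step kernel through an intermediate copy is bilinear in the second moments of
  that copy; this is how \<open>Sigma_x\<close> enters the main term.\<close>

lemma integral_vinner_mult: "(\<integral>z. vinner p x z * vinner p z y \<partial>P) = vquad p x (Sigma_x P) y"
proof -
  have "(\<integral>z. vinner p x z * vinner p z y \<partial>P) = (\<Sum>i<p. \<Sum>j<p. \<integral>z. x i * y j * (z i * z j) \<partial>P)"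
    unfolding vinner_mult_eq
    by (subst Bochner_Integration.integral_sum; (intro sum.cong refl Bochner_Integration.integral_sum)?;
      intro Bochner_Integration.integrable_sum integrable_mult_right integrable_coord_mult; simp)
  also have "\<dots> = (\<Sum>i<p. \<Sum>j<p. x i * y j * (\<integral>z. z i * z j \<partial>P))"
    by (simp only: integral_mult_right_zero)
  finally show ?thesis
    by (simp add: vquad_def Sigma_x_def mult_ac)
qed

lemma integrable_norm_power2_add:
  "integrable P2 (\<lambda>z. c + (vnorm p (fst z))\<^sup>2 + (vnorm p (snd z))\<^sup>2)"
  using integrable_norm_power2 integral_component(1,3)[of "\<lambda>x. (vnorm p x)\<^sup>2"] by simp

lemma abs_vinner_le_add: "\<bar>vinner p x y\<bar> \<le> (vnorm p x)\<^sup>2 + (vnorm p y)\<^sup>2"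
  using abs_vinner_le[of x y] sum_squares_bound[of "vnorm p x" "vnorm p y"]
    zero_le_power2[of "vnorm p x"] zero_le_power2[of "vnorm p y"] by linarith

lemma integrable_P2_vinner: "integrable P2 (\<lambda>z. vinner p (fst z) (snd z))"
  by (rule Bochner_Integration.integrable_bound[OF integrable_norm_power2_add[of 0]])
    (use abs_vinner_le_add in \<open>auto intro!: AE_I2\<close>)

lemma integral_P2_vinner: "(\<integral>z. vinner p (fst z) (snd z) \<partial>P2) = 0"
  unfolding pair.integral_fst'[OF integrable_P2_vinner, symmetric] by (simp add: integral_vinner)

lemma vdist_le: "vdist p x y \<le> 1 + 3 * ((vnorm p x)\<^sup>2 + (vnorm p y)\<^sup>2)"
proof -
  have "vdist p x y \<le> 1 + (vdist p x y)\<^sup>2"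
    using sum_squares_bound[of 1 "vdist p x y"] vdist_nonneg[of x y] by simp
  also have "\<dots> \<le> 1 + 3 * ((vnorm p x)\<^sup>2 + (vnorm p y)\<^sup>2)"
    unfolding vdist_power2 using abs_vinner_le_add[of x y] by (simp add: abs_le_iff)
  finally show ?thesis .
qed

lemma integrable_P2_vdist: "integrable P2 (\<lambda>z. vdist p (fst z) (snd z))"
  by (rule Bochner_Integration.integrable_bound[OF integrable_mult_right[OF integrable_norm_power2_add[of 1], of 3]])
    (use vdist_le in \<open>auto intro!: AE_I2 simp: vdist_nonneg order_trans[OF vdist_le]\<close>)

lemma integrable_vdist: "integrable P (vdist p x)" if "x \<in> space P"
proof (rule Bochner_Integration.integrable_bound)
  show "integrable P (\<lambda>y. 1 + 3 * ((vnorm p x)\<^sup>2 + (vnorm p y)\<^sup>2))"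
    using integrable_norm_power2 by simp
  show "vdist p x \<in> borel_measurable P"
    using measurable_compose[OF measurable_Pair1'[OF that] vdist_measurable] by simp
  show "AE y in P. norm (vdist p x y) \<le> norm (1 + 3 * ((vnorm p x)\<^sup>2 + (vnorm p y)\<^sup>2))"
    using vdist_le by (intro AE_I2) (auto simp: vdist_nonneg)
qed

lemma B_X_eq: "B_X p P = 2 * (\<integral>x. (vnorm p x)\<^sup>2 \<partial>P)"
proof -
  have "B_X p P = (\<integral>z. (vdist p (fst z) (snd z))\<^sup>2 \<partial>P2)"
    unfolding B_X_def
    using integral_two_copies[of 1 2 "\<lambda>z. (vdist p (fst z) (snd z))\<^sup>2"] by simp
  also have "\<dots> = 2 * (\<integral>x. (vnorm p x)\<^sup>2 \<partial>P)"
    unfolding vdist_power2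
    using integrable_norm_power2 integral_component[of "\<lambda>x. (vnorm p x)\<^sup>2"] integrable_P2_vinner
      integral_P2_vinner by simp
  finally show ?thesis .
qed

lemma B_X_pos:
  assumes "\<not> (AE x in P. \<forall>i<p. x i = 0)"
  shows "0 < B_X p P"
proof (rule ccontr)
  assume "\<not> 0 < B_X p P"
  then have "(\<integral>x. (vnorm p x)\<^sup>2 \<partial>P) = 0"
    unfolding B_X_eq by (intro antisym Bochner_Integration.integral_nonneg) auto
  then have "AE x in P. (vnorm p x)\<^sup>2 = 0"
    using integral_nonneg_eq_0_iff_AE[OF integrable_norm_power2] by simp
  then have "AE x in P. \<forall>i<p. x i = 0"
    by eventually_elim (simp add: vnorm_power2 sum_nonneg_eq_0_iff)
  with assms show False
    by simp
qed

section \<open>From conditional expectations to the double centred distance\<close>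

abbreviation dist_kernel :: kernel where
  "dist_kernel z \<equiv> vdist p (fst z) (snd z)"

lemma dcent_eq_double_centred:
  assumes ij: "i \<in> {1..4}" "j \<in> {1..4}" "i \<noteq> j"
  shows "AE \<omega> in copies P. dcent (copies P) p (copy i) (copy j) \<omega>
    = double_centred dist_kernel (\<omega> i, \<omega> j)"
proof -
  note c = cond_exp_given_copy[OF sets_P _ _ _ integrable_P2_vdist]
  have 1: "AE \<omega> in copies P. cond_exp_given (copies P) p (\<lambda>\<omega>. vdist p (\<omega> i) (\<omega> j)) (copy i) \<omega>
      = row_mean dist_kernel (\<omega> i)"
    using c[OF ij] by simp
  have 2: "AE \<omega> in copies P. cond_exp_given (copies P) p (\<lambda>\<omega>. vdist p (\<omega> i) (\<omega> j)) (copy j) \<omega>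
      = row_mean dist_kernel (\<omega> j)"
    using c[OF ij(2,1)] ij(3) by (simp add: vdist_commute)
  have 3: "(\<integral>\<omega>. vdist p (\<omega> i) (\<omega> j) \<partial>copies P) = integral\<^sup>L P2 dist_kernel"
    using integral_two_copies[OF ij, of dist_kernel] by simp
  show ?thesis
    using 1 2 by eventually_elim (simp add: dcent_def double_centred_def 3)
qed

lemma integral_gfun:
  "(\<integral>\<omega>. gfun (copies P) p copy \<omega> \<partial>copies P)
    = cycle_at 1 2 3 4 (double_centred dist_kernel) (double_centred dist_kernel)
        (double_centred dist_kernel) (double_centred dist_kernel)"
proof -
  have [measurable]: "double_centred dist_kernel \<in> borel_measurable P2"
    unfolding double_centred_def by measurable
  let ?G = "\<lambda>\<omega>. double_centred dist_kernel (\<omega> 1, \<omega> 2) * double_centred dist_kernel (\<omega> 1, \<omega> 3)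
    * double_centred dist_kernel (\<omega> 2, \<omega> 4) * double_centred dist_kernel (\<omega> 3, \<omega> 4)"
  have d: "AE \<omega> in copies P. dcent (copies P) p (copy 1) (copy 2) \<omega> = double_centred dist_kernel (\<omega> 1, \<omega> 2)"
      "AE \<omega> in copies P. dcent (copies P) p (copy 1) (copy 3) \<omega> = double_centred dist_kernel (\<omega> 1, \<omega> 3)"
      "AE \<omega> in copies P. dcent (copies P) p (copy 2) (copy 4) \<omega> = double_centred dist_kernel (\<omega> 2, \<omega> 4)"
      "AE \<omega> in copies P. dcent (copies P) p (copy 3) (copy 4) \<omega> = double_centred dist_kernel (\<omega> 3, \<omega> 4)"
    by (rule dcent_eq_double_centred; simp)+
  have AE: "AE \<omega> in copies P. gfun (copies P) p copy \<omega> = ?G \<omega>"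
    using d unfolding gfun_def by eventually_elim simp
  \<comment> \<open>Equality almost everywhere transfers the integral only between measurable
    functions, so \<open>gfun\<close>, built from chosen versions, must be shown measurable
    itself.\<close>
  have [measurable]: "(\<lambda>\<omega>. cond_exp_given (copies P) p f Y \<omega>) \<in> borel_measurable (copies P)" for f Y
    unfolding cond_exp_given_def by measurable
  have vd: "(\<lambda>\<omega>. vdist p (\<omega> i) (\<omega> j)) \<in> borel_measurable (copies P)"
    if "i \<in> {1..4}" "j \<in> {1..4}" for i j
    using that measurable_compose[OF measurable_Pair[OF copy_measurable copy_measurable] vdist_measurable]
    by simp
  have dm: "dcent (copies P) p (copy i) (copy j) \<in> borel_measurable (copies P)"
    if "i \<in> {1..4}" "j \<in> {1..4}" for i j
    unfolding dcent_def[abs_def]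
    by (intro borel_measurable_add borel_measurable_diff borel_measurable_const vd that) measurable
  have "gfun (copies P) p copy \<in> borel_measurable (copies P)"
    unfolding gfun_def[abs_def] by (intro borel_measurable_times dm) auto
  moreover have "?G \<in> borel_measurable (copies P)"
    by measurable
  ultimately show ?thesis
    unfolding cycle_at_def by (intro integral_cong_AE AE)
qed

section \<open>Expansion of the distance around its root mean square\<close>

abbreviation inner_kernel :: kernel where
  "inner_kernel z \<equiv> vinner p (fst z) (snd z)"

definition norm_dev :: "(nat \<Rightarrow> real) \<Rightarrow> real" where
  "norm_dev x = (vnorm p x)\<^sup>2 - (\<integral>y. (vnorm p y)\<^sup>2 \<partial>P)"

definition dist_dev :: kernel where
  "dist_dev z = norm_dev (fst z) + norm_dev (snd z) - 2 * inner_kernel z"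

lemma norm_dev_measurable [measurable]: "norm_dev \<in> borel_measurable P"
  unfolding norm_dev_def[abs_def] by measurable

lemma dist_dev_measurable [measurable]: "dist_dev \<in> borel_measurable P2"
  unfolding dist_dev_def[abs_def] by measurable

lemma integrable_norm_dev: "integrable P norm_dev"
  unfolding norm_dev_def[abs_def] using integrable_norm_power2 by simp

lemma integral_norm_dev: "integral\<^sup>L P norm_dev = 0"
  unfolding norm_dev_def[abs_def] using integrable_norm_power2 by (simp add: prob_space)

lemma vdist_power2_eq_dev: "(vdist p x y)\<^sup>2 = B_X p P + dist_dev (x, y)"
  by (simp add: dist_dev_def norm_dev_def B_X_eq vdist_power2)

text \<open>Together with the total mean 0 this shows what double centring does to
  \<open>dist_dev\<close>: both \<open>norm_dev\<close> terms cancel and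
  \<open>- 2 * inner_kernel\<close> remains.\<close>

lemma row_mean_dist_dev: "row_mean dist_dev x = norm_dev x"
  unfolding row_mean_def dist_dev_def
  using integrable_norm_dev integrable_vinner[of x] integral_norm_dev integral_vinner[of x]
  by (simp add: prob_space)

lemma integrable_dist_dev: "integrable P2 dist_dev"
  unfolding dist_dev_def[abs_def]
  using integrable_norm_dev integrable_P2_vinner integral_component(1,3)[of norm_dev] by simp

lemma integral_dist_dev: "integral\<^sup>L P2 dist_dev = 0"
  unfolding dist_dev_def[abs_def]
  using integrable_norm_dev integrable_P2_vinner integral_P2_vinner integral_norm_dev
    integral_component[of norm_dev] by simp

lemma integrable_row_dist_dev: "integrable P (\<lambda>y. dist_dev (x, y))"
  unfolding dist_dev_def using integrable_norm_dev integrable_vinner[of x] by simp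

text \<open>The deviation is quadratic in the norm and needs its moment of order
  \<open>2 * s\<close>; the inner product is dominated by a product of norms of independent copies,
  for which order \<open>s\<close> is enough.\<close>

lemma integrable_powr_moments:
  assumes "1 \<le> s" and m: "integrable P (\<lambda>x. vnorm p x powr (2 * s))"
  shows "integrable P (\<lambda>x. \<bar>norm_dev x\<bar> powr s)"
    and "integrable P2 (\<lambda>z. \<bar>inner_kernel z\<bar> powr s)"
proof -
  define c where "c = (\<integral>y. (vnorm p y)\<^sup>2 \<partial>P)"
  have c: "0 \<le> c"
    unfolding c_def by (rule Bochner_Integration.integral_nonneg) simp
  have n: "vnorm p x powr (2 * s) = ((vnorm p x)\<^sup>2) powr s" for x
    using vnorm_nonneg[of x] by (cases "vnorm p x = 0") (auto simp: powr_powr simp flip: powr_numeral)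
  show "integrable P (\<lambda>x. \<bar>norm_dev x\<bar> powr s)"
  proof (rule Bochner_Integration.integrable_bound)
    show "integrable P (\<lambda>x. vnorm p x powr (2 * s) + c powr s)"
      using m by simp
    show "AE x in P. norm (\<bar>norm_dev x\<bar> powr s) \<le> norm (vnorm p x powr (2 * s) + c powr s)"
    proof (rule AE_I2)
      fix x
      have "\<bar>norm_dev x\<bar> \<le> max ((vnorm p x)\<^sup>2) c"
        using c zero_le_power2[of "vnorm p x"] unfolding norm_dev_def c_def[symmetric] max_def
        by (auto simp: abs_le_iff)
      then have "\<bar>norm_dev x\<bar> powr s \<le> max ((vnorm p x)\<^sup>2) c powr s"
        using assms(1) by (intro powr_mono2) auto
      also have "\<dots> \<le> vnorm p x powr (2 * s) + c powr s"
        by (auto simp: n max_def)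
      finally show "norm (\<bar>norm_dev x\<bar> powr s) \<le> norm (vnorm p x powr (2 * s) + c powr s)"
        by simp
    qed
  qed simp
  have i: "integrable P (\<lambda>x. vnorm p x powr s)"
    by (rule integrable_le_one_plus[OF _ m]) (use assms(1) in \<open>auto intro: powr_le_one_plus_powr simp: vnorm_nonneg\<close>)
  have i2: "integrable P2 (\<lambda>z. vnorm p (fst z) powr s * vnorm p (snd z) powr s)"
    using i by (intro pair.Fubini_integrable) (auto simp: abs_mult)
  show "integrable P2 (\<lambda>z. \<bar>inner_kernel z\<bar> powr s)"
  proof (rule Bochner_Integration.integrable_bound[OF i2])
    show "AE z in P2. norm (\<bar>inner_kernel z\<bar> powr s)
        \<le> norm (vnorm p (fst z) powr s * vnorm p (snd z) powr s)"
    proof (rule AE_I2)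
      fix z
      have "\<bar>inner_kernel z\<bar> powr s \<le> (vnorm p (fst z) * vnorm p (snd z)) powr s"
        using assms(1) abs_vinner_le by (intro powr_mono2) auto
      then show "norm (\<bar>inner_kernel z\<bar> powr s)
          \<le> norm (vnorm p (fst z) powr s * vnorm p (snd z) powr s)"
        by (simp add: powr_mult vnorm_nonneg)
    qed
  qed simp
qed

lemma L_x_eq: "L_x p P \<tau> = (\<integral>x. \<bar>norm_dev x\<bar> powr (2 + 2 * \<tau>) \<partial>P)
    + (\<integral>z. \<bar>inner_kernel z\<bar> powr (2 + 2 * \<tau>) \<partial>P2)"
  unfolding L_x_def norm_dev_def
  using integral_two_copies[of 1 2 "\<lambda>z. \<bar>inner_kernel z\<bar> powr (2 + 2 * \<tau>)"] by simp

text \<open>Counting the inner product twice, four terms are each at most the maximum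
  \<open>m\<close>; 64 is \<open>4 ^ 3\<close>, by \<open>s \<le> 3\<close>.\<close>

lemma dist_dev_powr_le:
  assumes "0 \<le> s" "s \<le> 3"
  shows "\<bar>dist_dev z\<bar> powr s \<le> 64 * (\<bar>norm_dev (fst z)\<bar> powr s + \<bar>norm_dev (snd z)\<bar> powr s
    + \<bar>inner_kernel z\<bar> powr s)"
proof -
  define m where "m = max (max \<bar>norm_dev (fst z)\<bar> \<bar>norm_dev (snd z)\<bar>) \<bar>inner_kernel z\<bar>"
  have "\<bar>dist_dev z\<bar> \<le> \<bar>norm_dev (fst z)\<bar> + \<bar>norm_dev (snd z)\<bar> + 2 * \<bar>inner_kernel z\<bar>"
    unfolding dist_dev_def by linarith
  also have "\<dots> \<le> 4 * m"
  proof -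
    have "\<bar>norm_dev (fst z)\<bar> \<le> m" "\<bar>norm_dev (snd z)\<bar> \<le> m" "\<bar>inner_kernel z\<bar> \<le> m"
      by (auto simp: m_def)
    then show ?thesis
      by simp
  qed
  finally have "\<bar>dist_dev z\<bar> powr s \<le> (4 * m) powr s"
    using assms by (intro powr_mono2) auto
  also have "\<dots> = 4 powr s * m powr s"
    by (simp add: powr_mult m_def)
  also have "\<dots> \<le> 64 * m powr s"
  proof (rule mult_right_mono)
    have "(4::real) powr s \<le> 4 powr 3"
      using assms by (intro powr_mono) auto
    then show "(4::real) powr s \<le> 64"
      by simp
  qed simp
  also have "m powr s \<le> \<bar>norm_dev (fst z)\<bar> powr s + \<bar>norm_dev (snd z)\<bar> powr s + \<bar>inner_kernel z\<bar> powr s"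
    by (auto simp: m_def max_def)
  finally show ?thesis
    by simp
qed

text \<open>128 is twice 64: the deviation of the norm occurs for both arguments, but
  \<open>L_x\<close> counts it once.\<close>

lemma dist_dev_moment:
  assumes \<tau>: "0 < \<tau>" "\<tau> \<le> 1 / 2" and m: "integrable P (\<lambda>x. vnorm p x powr (4 + 4 * \<tau>))"
  shows "integrable P2 (\<lambda>z. \<bar>dist_dev z\<bar> powr (2 + 2 * \<tau>))"
    and "(\<integral>z. \<bar>dist_dev z\<bar> powr (2 + 2 * \<tau>) \<partial>P2) \<le> 128 * L_x p P \<tau>"
proof -
  define s where "s = 2 + 2 * \<tau>"
  have s: "0 \<le> s" "1 \<le> s" "s \<le> 3"
    using \<tau> by (auto simp: s_def)
  have "integrable P (\<lambda>x. vnorm p x powr (2 * s))"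
    using m by (simp add: s_def algebra_simps)
  note mom = integrable_powr_moments[OF s(2) this]
  note fs = integral_component[of "\<lambda>x. \<bar>norm_dev x\<bar> powr s"]
  let ?D = "\<lambda>z. 64 * (\<bar>norm_dev (fst z)\<bar> powr s + \<bar>norm_dev (snd z)\<bar> powr s
    + \<bar>inner_kernel z\<bar> powr s)"
  have D: "integrable P2 ?D"
    using mom fs by simp
  show i: "integrable P2 (\<lambda>z. \<bar>dist_dev z\<bar> powr (2 + 2 * \<tau>))"
    unfolding s_def[symmetric]
    by (rule Bochner_Integration.integrable_bound[OF D])
      (use dist_dev_powr_le[OF s(1,3)] in \<open>auto intro!: AE_I2 order_trans[OF _ abs_ge_self]
        simp del: distrib_left_numeral\<close>)
  have "(\<integral>z. \<bar>dist_dev z\<bar> powr s \<partial>P2) \<le> integral\<^sup>L P2 ?D"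
    using i D dist_dev_powr_le[OF s(1,3)] unfolding s_def[symmetric] by (rule integral_mono)
  also have "\<dots> = 64 * (2 * (\<integral>x. \<bar>norm_dev x\<bar> powr s \<partial>P) + (\<integral>z. \<bar>inner_kernel z\<bar> powr s \<partial>P2))"
    using mom fs by simp
  also have "\<dots> \<le> 128 * L_x p P \<tau>"
    using Bochner_Integration.integral_nonneg[of P2 "\<lambda>z. \<bar>inner_kernel z\<bar> powr s"]
    unfolding L_x_eq s_def[symmetric] by simp
  finally show "(\<integral>z. \<bar>dist_dev z\<bar> powr (2 + 2 * \<tau>) \<partial>P2) \<le> 128 * L_x p P \<tau>"
    unfolding s_def .
qed

text \<open>With \<open>D\<close> the distance and \<open>b\<close> the root of \<open>B_X\<close>,
  \<open>dist_dev\<close> factors as \<open>(D - b) * (D + b)\<close>. The second factor dominates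
  both \<open>\<bar>D - b\<bar>\<close> and \<open>b\<close>, which gives the two estimates.\<close>

lemma vdist_remainder_le:
  assumes "0 < B_X p P"
  shows "(vdist p x y - sqrt (B_X p P))\<^sup>2 \<le> \<bar>dist_dev (x, y)\<bar>"
    and "(vdist p x y - sqrt (B_X p P))\<^sup>2 * B_X p P \<le> (dist_dev (x, y))\<^sup>2"
proof -
  define D b where "D = vdist p x y" and "b = sqrt (B_X p P)"
  have b: "0 < b" "b\<^sup>2 = B_X p P" and D: "0 \<le> D"
    using assms by (auto simp: b_def D_def vdist_nonneg)
  have V: "dist_dev (x, y) = (D - b) * (D + b)"
    using vdist_power2_eq_dev[of x y] b by (simp add: D_def power2_eq_square algebra_simps)
  have "\<bar>D - b\<bar> * \<bar>D - b\<bar> \<le> \<bar>D - b\<bar> * \<bar>D + b\<bar>"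
    using b D by (intro mult_left_mono) auto
  then show "(vdist p x y - sqrt (B_X p P))\<^sup>2 \<le> \<bar>dist_dev (x, y)\<bar>"
    by (simp add: V D_def[symmetric] b_def[symmetric] abs_mult power2_eq_square)
  have "(D - b)\<^sup>2 * b\<^sup>2 \<le> (D - b)\<^sup>2 * (D + b)\<^sup>2"
    using b D by (intro mult_left_mono power_mono) auto
  then show "(vdist p x y - sqrt (B_X p P))\<^sup>2 * B_X p P \<le> (dist_dev (x, y))\<^sup>2"
    unfolding V D_def[symmetric] b_def[symmetric] power_mult_distrib b(2) .
qed

text \<open>The remainder is affine in \<open>dist_dev\<close> and the distance, and double centring
  is linear and kills constants. Extracting \<open>r / b\<close> leaves a kernel normalised to scale
  \<open>r\<close>; the sign disappears in a product of four.\<close>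

lemma double_centred_dist_kernel:
  fixes r :: real
  assumes B: "0 < B_X p P" and "r \<noteq> 0" and z: "z \<in> space P2"
  defines "b \<equiv> sqrt (B_X p P)"
  shows "double_centred dist_kernel z = - (r / b) *
    (inner_kernel z / r + double_centred (\<lambda>z. (dist_kernel z - b)\<^sup>2 / (2 * r)) z)"
proof -
  have b: "0 < b" "b * b = B_X p P"
    using B by (auto simp: b_def)
  define q :: kernel where "q = (\<lambda>z. (dist_kernel z - b)\<^sup>2 / (2 * r))"
  have q: "q z = (b / r) * (b + dist_dev z / (2 * b) - dist_kernel z)" for z
    using vdist_power2_eq_dev[of "fst z" "snd z"] b \<open>r \<noteq> 0\<close>
    by (simp add: q_def power2_diff field_simps) (simp add: power2_eq_square)
  have row: "row_mean q x = (b / r) * (b + norm_dev x / (2 * b) - row_mean dist_kernel x)"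
    if "x \<in> space P" for x
    using integrable_row_dist_dev[of x] integrable_vdist[OF that] row_mean_dist_dev[of x]
    unfolding row_mean_def q by (simp add: prob_space)
  have int: "integral\<^sup>L P2 q = (b / r) * (b - integral\<^sup>L P2 dist_kernel)"
    using integrable_dist_dev integrable_P2_vdist integral_dist_dev
    unfolding q by (simp add: pair.prob_space)
  have xy: "fst z \<in> space P" "snd z \<in> space P"
    using z by (auto simp: space_pair_measure)
  have *: "double_centred q z = (b / r) * (- inner_kernel z / b - double_centred dist_kernel z)"
    unfolding double_centred_def int row[OF xy(1)] row[OF xy(2)] q[of z] dist_dev_def
    using b \<open>r \<noteq> 0\<close> by (simp add: field_simps)
  show ?thesis
    unfolding q_def[symmetric] * using b \<open>r \<noteq> 0\<close> by (simp add: field_simps)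
qed

text \<open>Four edges give the prefactor \<open>r ^ 4 / B\<^sup>2\<close>. In the main term it
  cancels the normalisation of \<open>a\<close>; in the error it combines with
  \<open>(r / B) powr (2 * \<tau>)\<close>. The scale \<open>r\<close> is only bounded from below,
  so that it can also tend to 0 when \<open>L_x\<close> vanishes.\<close>

lemma abs_integral_gfun_le:
  fixes r \<tau> :: real
  assumes \<tau>: "0 < \<tau>" "\<tau> \<le> 1 / 2" and m: "integrable P (\<lambda>x. vnorm p x powr (4 + 4 * \<tau>))"
    and B: "0 < B_X p P" and r: "0 < r" "L_x p P \<tau> \<le> r powr (2 + 2 * \<tau>)"
  shows "\<bar>\<integral>\<omega>. gfun (copies P) p copy \<omega> \<partial>copies P\<bar>
    \<le> B_X p P powr (- 2) * (\<integral>\<omega>. (vquad p (copy 1 \<omega>) (Sigma_x P) (copy 2 \<omega>))\<^sup>2 \<partial>copies P)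
      + 10 ^ 7 * B_X p P powr (- (2 + 2 * \<tau>)) * r powr (4 + 2 * \<tau>)"
proof -
  define s where "s = 2 + 2 * \<tau>"
  define B where "B = B_X p P"
  define b where "b = sqrt B"
  define a :: kernel where "a = (\<lambda>z. inner_kernel z / r)"
  define q :: kernel where "q = (\<lambda>z. (dist_kernel z - b)\<^sup>2 / (2 * r))"
  define v :: kernel where "v = (\<lambda>z. \<bar>dist_dev z\<bar> / r)"
  define K :: kernel where "K = (\<lambda>z. a z + double_centred q z)"
  have B0: "0 < B" and b: "0 < b" "b\<^sup>2 = B"
    using B by (auto simp: B_def b_def)
  have s: "1 \<le> s"
    using \<tau> by (simp add: s_def)
  have "integrable P (\<lambda>x. vnorm p x powr (2 * s))"
    using m by (simp add: s_def algebra_simps)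
  note mom = integrable_powr_moments[OF s this]
  have [measurable]: "a \<in> borel_measurable P2" "q \<in> borel_measurable P2" "v \<in> borel_measurable P2"
    unfolding a_def q_def v_def by measurable
  have a_s: "\<bar>a z\<bar> powr s = \<bar>inner_kernel z\<bar> powr s / r powr s" for z
    using r by (simp add: a_def powr_divide abs_divide)
  have v_s: "v z powr s = \<bar>dist_dev z\<bar> powr s / r powr s" for z
    using r by (simp add: v_def powr_divide)
  have ia: "integrable P2 (\<lambda>z. \<bar>a z\<bar> powr (2 + 2 * \<tau>))" "(\<integral>z. \<bar>a z\<bar> powr (2 + 2 * \<tau>) \<partial>P2) \<le> 1"
  proof -
    show "integrable P2 (\<lambda>z. \<bar>a z\<bar> powr (2 + 2 * \<tau>))"
      using mom unfolding s_def[symmetric] a_s by simp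
    have "(\<integral>z. \<bar>inner_kernel z\<bar> powr s \<partial>P2) \<le> L_x p P \<tau>"
      using Bochner_Integration.integral_nonneg[of P "\<lambda>x. \<bar>norm_dev x\<bar> powr s"]
      by (simp add: L_x_eq s_def)
    then show "(\<integral>z. \<bar>a z\<bar> powr (2 + 2 * \<tau>) \<partial>P2) \<le> 1"
      using r unfolding s_def[symmetric] a_s by (simp add: field_simps)
  qed
  have iv: "integrable P2 (\<lambda>z. v z powr (2 + 2 * \<tau>))" "(\<integral>z. v z powr (2 + 2 * \<tau>) \<partial>P2) \<le> 128"
    using dist_dev_moment[OF \<tau> m] r unfolding s_def[symmetric] v_s by (auto simp: field_simps)
  have sym: "a (x, y) = a (y, x)" for x y
    by (simp add: a_def vinner_commute)
  have cent: "(\<integral>y. a (x, y) \<partial>P) = 0" for x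
    by (simp add: a_def integral_vinner)
  have q: "0 \<le> q z" "q z \<le> v z" "q z \<le> (r / B) * (v z)\<^sup>2" for z
  proof -
    note rem = vdist_remainder_le[OF B, of "fst z" "snd z", folded B_def, folded b_def, simplified]
    show "0 \<le> q z"
      using r by (simp add: q_def)
    show "q z \<le> v z"
      using rem(1) r by (simp add: q_def v_def field_simps)
    have "q z \<le> (dist_dev z)\<^sup>2 / (2 * r * B)"
      using rem(2) r B0 by (simp add: q_def field_simps)
    also have "\<dots> \<le> (dist_dev z)\<^sup>2 / (r * B)"
      using r B0 by (intro divide_left_mono) auto
    also have "\<dots> = (r / B) * (v z)\<^sup>2"
      using r B0 by (simp add: v_def power_divide) (simp add: power2_eq_square)
    finally show "q z \<le> (r / B) * (v z)\<^sup>2" .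
  qed
  have "\<bar>cycle_at 1 2 3 4 K K K K\<bar> \<le> \<bar>cycle_at 1 2 3 4 a a a a\<bar> + 10 ^ 7 * (r / B) powr (2 * \<tau>)"
    unfolding K_def by (rule abs_cycle_perturbation_le[OF \<tau> _ _ _ _ sym cent ia iv q]) (use r B0 in auto)
  moreover have "cycle_at 1 2 3 4 a a a a
      = (\<integral>\<omega>. (vquad p (copy 1 \<omega>) (Sigma_x P) (copy 2 \<omega>))\<^sup>2 \<partial>copies P) / r ^ 4"
  proof -
    have i: "integrable P (\<lambda>z. a (x, z) * a (z, y))" for x y
      using integrable_vinner_mult[of x y] by (simp add: a_def)
    have "integrable P2 (\<lambda>z. (a z)\<^sup>2)"
      by (rule pair.integrable_le_one_plus[OF _ ia(1)]) (use \<tau> in \<open>auto intro: power2_le_one_plus_powr\<close>)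
    then have "sq_int a"
      by (simp add: sq_int_def)
    from cycle_at_eq_integral_power2[OF this sym i]
    have "cycle_at 1 2 3 4 a a a a
        = (\<integral>\<omega>. (\<integral>z. a (\<omega> 1, z) * a (z, \<omega> 2) \<partial>P)\<^sup>2 \<partial>copies P)" .
    moreover have "(\<integral>z. a (x, z) * a (z, y) \<partial>P) = vquad p x (Sigma_x P) y / r\<^sup>2" for x y
      using integral_vinner_mult[of x y] by (simp add: a_def power2_eq_square)
    ultimately show ?thesis
      by (simp add: power_divide flip: power_mult)
  qed
  moreover have "(\<integral>\<omega>. gfun (copies P) p copy \<omega> \<partial>copies P) = (r ^ 4 / B\<^sup>2) * cycle_at 1 2 3 4 K K K K"
  proof -
    have *: "double_centred dist_kernel (\<omega> i, \<omega> j) = - (r / b) * K (\<omega> i, \<omega> j)"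
      if "\<omega> \<in> space (copies P)" "i \<in> {1..4}" "j \<in> {1..4}" for \<omega> i j
    proof -
      have "(\<omega> i, \<omega> j) \<in> space P2"
        using that by (auto simp: space_pair_measure space_PiM)
      from double_centred_dist_kernel[OF B less_imp_neq[OF r(1), symmetric] this] show ?thesis
        by (simp add: K_def a_def q_def b_def B_def)
    qed
    have "(\<integral>\<omega>. gfun (copies P) p copy \<omega> \<partial>copies P)
        = (\<integral>\<omega>. (r / b) ^ 4 * (K (\<omega> 1, \<omega> 2) * K (\<omega> 1, \<omega> 3) * K (\<omega> 2, \<omega> 4) * K (\<omega> 3, \<omega> 4)) \<partial>copies P)"
      unfolding integral_gfun cycle_at_def
      by (intro Bochner_Integration.integral_cong refl) (simp add: * power4_eq_xxxx)
    also have "\<dots> = (r / b) ^ 4 * cycle_at 1 2 3 4 K K K K"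
      by (simp add: cycle_at_def)
    also have "(r / b) ^ 4 = r ^ 4 / B\<^sup>2"
      by (simp add: power_divide b(2)[symmetric] flip: power_mult)
    finally show ?thesis .
  qed
  ultimately have "\<bar>\<integral>\<omega>. gfun (copies P) p copy \<omega> \<partial>copies P\<bar> \<le> (r ^ 4 / B\<^sup>2) *
      (\<bar>(\<integral>\<omega>. (vquad p (copy 1 \<omega>) (Sigma_x P) (copy 2 \<omega>))\<^sup>2 \<partial>copies P) / r ^ 4\<bar>
        + 10 ^ 7 * (r / B) powr (2 * \<tau>))"
    by (simp only: abs_mult) (intro mult_mono; simp)
  also have "\<dots> = B powr (- 2) * (\<integral>\<omega>. (vquad p (copy 1 \<omega>) (Sigma_x P) (copy 2 \<omega>))\<^sup>2 \<partial>copies P)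
      + 10 ^ 7 * ((r ^ 4 / B\<^sup>2) * (r / B) powr (2 * \<tau>))"
  proof -
    have "\<bar>m / r ^ 4\<bar> = m / r ^ 4" if "0 \<le> m" for m
      using that by simp
    then show ?thesis
      using r B0 by (simp add: Bochner_Integration.integral_nonneg powr_minus field_simps)
  qed
  also have "(r ^ 4 / B\<^sup>2) * (r / B) powr (2 * \<tau>) = B powr (- (2 + 2 * \<tau>)) * r powr (4 + 2 * \<tau>)"
  proof -
    have "B powr (- (2 + 2 * \<tau>)) = inverse (B\<^sup>2 * B powr (2 * \<tau>))"
      unfolding powr_minus using B0 by (simp add: powr_add)
    moreover have "r powr (4 + 2 * \<tau>) = r ^ 4 * r powr (2 * \<tau>)"
      using r by (simp add: powr_add)
    ultimately show ?thesis
      using r B0 by (simp add: powr_divide divide_simps)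
  qed
  finally show ?thesis
    by (simp add: B_def)
qed

end

theorem proposition6:
  shows "\<exists>C::real. C > 0 \<and>
    (\<forall>(p::nat) (\<tau>::real) (P :: (nat \<Rightarrow> real) measure).
      0 < \<tau> \<longrightarrow> \<tau> \<le> 1 / 2 \<longrightarrow>
      prob_space P \<longrightarrow> sets P = sets (Rvec p) \<longrightarrow>
      integrable P (\<lambda>x. vnorm p x powr (4 + 4 * \<tau>)) \<longrightarrow>
      (\<forall>i<p. (\<integral>x. x i \<partial>P) = 0) \<longrightarrow>
      \<not> (AE x in P. \<forall>i<p. x i = 0) \<longrightarrow>
      \<bar>\<integral>\<omega>. gfun (copies P) p copy \<omega> \<partial>copies P\<bar>
        \<le> B_X p P powr (- 2) *
            (\<integral>\<omega>. (vquad p (copy 1 \<omega>) (Sigma_x P) (copy 2 \<omega>))\<^sup>2 \<partial>copies P)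
          + C * B_X p P powr (- (2 + 2 * \<tau>)) * L_x p P \<tau> powr ((2 + \<tau>) / (1 + \<tau>)))"
proof (intro exI[of _ "10 ^ 7"] conjI allI impI)
  fix p :: nat and \<tau> :: real and P :: "(nat \<Rightarrow> real) measure"
  assume \<tau>: "0 < \<tau>" "\<tau> \<le> 1 / 2" and P: "prob_space P" and sets: "sets P = sets (Rvec p)"
    and m: "integrable P (\<lambda>x. vnorm p x powr (4 + 4 * \<tau>))"
    and mean: "\<forall>i<p. (\<integral>x. x i \<partial>P) = 0" and nz: "\<not> (AE x in P. \<forall>i<p. x i = 0)"
  interpret prob_space P by fact
  have meas: "vnorm p \<in> borel_measurable P"
    unfolding measurable_cong_sets[OF sets refl] vnorm_def[abs_def] L2_set_def
    by measurable
  have "integrable P (\<lambda>x. (vnorm p x)\<^sup>2)"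
  proof (rule integrable_le_one_plus[OF _ m])
    show "(vnorm p x)\<^sup>2 \<le> 1 + vnorm p x powr (4 + 4 * \<tau>)" for x
      using power2_le_one_plus_powr[of "4 + 4 * \<tau>" "vnorm p x"] \<tau> by (simp add: vnorm_def)
  qed (use meas in auto)
  then interpret random_vector P p
    using sets mean by unfold_locales auto
  note B = B_X_pos[OF nz]
  let ?M = "B_X p P powr (- 2) * (\<integral>\<omega>. (vquad p (copy 1 \<omega>) (Sigma_x P) (copy 2 \<omega>))\<^sup>2 \<partial>copies P)"
  let ?c = "10 ^ 7 * B_X p P powr (- (2 + 2 * \<tau>))"
  have L0: "0 \<le> L_x p P \<tau>"
    unfolding L_x_def by (intro add_nonneg_nonneg Bochner_Integration.integral_nonneg) auto
  have c0: "0 < ?c"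
    using B by simp
  show "\<bar>\<integral>\<omega>. gfun (copies P) p copy \<omega> \<partial>copies P\<bar>
      \<le> ?M + ?c * L_x p P \<tau> powr ((2 + \<tau>) / (1 + \<tau>))"
  proof (cases "L_x p P \<tau> = 0")
    case False
    \<comment> \<open>The smallest admissible scale, for which
      \<open>r powr (4 + 2 * \<tau>)\<close> is the required power of \<open>L_x\<close>.\<close>
    define r where "r = L_x p P \<tau> powr (1 / (2 + 2 * \<tau>))"
    have "0 < r" "L_x p P \<tau> \<le> r powr (2 + 2 * \<tau>)"
      using False L0 \<tau> by (auto simp: r_def powr_powr)
    moreover have "r powr (4 + 2 * \<tau>) = L_x p P \<tau> powr ((2 + \<tau>) / (1 + \<tau>))"
    proof -
      have "(4 + 2 * \<tau>) / (2 + 2 * \<tau>) = (2 + \<tau>) / (1 + \<tau>)"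
        using \<tau> by (simp add: field_simps)
      then show ?thesis
        by (simp add: r_def powr_powr)
    qed
    ultimately show ?thesis
      using abs_integral_gfun_le[OF \<tau> m B, of r] by simp
  next
    case True
    \<comment> \<open>Every positive \<open>r\<close> is admissible now, so the error can be made
      equal to any \<open>e > 0\<close>. The limit is the claim, because \<open>0 powr _\<close> is
      0.\<close>
    have "\<bar>\<integral>\<omega>. gfun (copies P) p copy \<omega> \<partial>copies P\<bar> \<le> ?M + e" if "0 < e" for e
    proof -
      define r where "r = (e / ?c) powr (1 / (4 + 2 * \<tau>))"
      have "0 < r" "r powr (4 + 2 * \<tau>) = e / ?c"
        using that c0 \<tau> by (auto simp: r_def powr_powr)
      then show ?thesis
        using abs_integral_gfun_le[OF \<tau> m B, of r] True c0 by simp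
    qed
    then have "\<bar>\<integral>\<omega>. gfun (copies P) p copy \<omega> \<partial>copies P\<bar> \<le> ?M"
      by (rule field_le_epsilon)
    then show ?thesis
      by (simp add: True)
  qed
qed simp

end
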